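(* The Hilbert series of the coordinate ring of the cone of ${\mathrm{O}}(4)$ is \[\mathrm{H}(\mathcal{O}(\mathcal{C}({\mathrm{O}}(4)));t)=\frac{1+9t+27t^2+19t^3-30t^4+34t^5-35t^6+21t^7-7t^8+t^9}{(1-t)^7}.\] Equivalently, $\dim_{\mathbb{C}}\mathcal{O}(\mathcal{C}({\mathrm{O}}(4)))_d=p(d)$ for $d\ne 2$ and $=p(2)-1=118$ for $d=2$, where $p(d)=\frac{1}{18}d^6+\frac23d^5+\frac{20}{9}d^4+4d^3+\frac{85}{18}d^2+\frac{10}{3}d+1$.
   Context: ${\mathrm{O}}(4)=\{M\in\mathbb{C}^{4\times4}\mid M^TM=I\}$. The cone $\mathcal{C}({\mathrm{O}}(4))$ is the Zariski closure in $\mathbb{C}^{4\times 4}$ of $\{cM\mid c\in\mathbb{C},M\in{\mathrm{O}}(4)\}$; its coordinate ring is the quotient of the standard graded polynomial ring $\mathbb{C}[x_{ij}\mid 1\le i,j\le 4]$ by the homogeneous vanishing ideal, with induced grading and degree $d$ component $\mathcal{O}(\mathcal{C}({\mathrm{O}}(4)))_d$. The Hilbert series of a graded algebra $A=\bigoplus_dA_d$ is $\sum_d\dim_{\mathbb{C}}(A_d)t^d$. *)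

theory Defs
  imports "HOL-Analysis.Analysis" "HOL-Library.Numeral_Type" "HOL-Library.Function_Algebras"
    "HOL-Computational_Algebra.Formal_Power_Series"
begin

type_synonym cmat4 = "complex^4^4"

definition monomial_fn :: "(4 \<Rightarrow> 4 \<Rightarrow> nat) \<Rightarrow> cmat4 \<Rightarrow> complex" where
  "monomial_fn a M = (\<Prod>i\<in>UNIV. \<Prod>j\<in>UNIV. (M $ i $ j) ^ (a i j))"

definition mono_deg :: "(4 \<Rightarrow> 4 \<Rightarrow> nat) \<Rightarrow> nat" where
  "mono_deg a = (\<Sum>i\<in>UNIV. \<Sum>j\<in>UNIV. a i j)"

definition fscale :: "complex \<Rightarrow> ('a \<Rightarrow> complex) \<Rightarrow> ('a \<Rightarrow> complex)" where
  "fscale c f = (\<lambda>x. c * f x)"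

definition poly_fns :: "(cmat4 \<Rightarrow> complex) set" where
  "poly_fns = module.span fscale {monomial_fn a | a. True}"

definition hom_poly_fns :: "nat \<Rightarrow> (cmat4 \<Rightarrow> complex) set" where
  "hom_poly_fns d = module.span fscale {monomial_fn a | a. mono_deg a = d}"

definition O4 :: "cmat4 set" where
  "O4 = {M. transpose M ** M = mat 1}"

definition cone_set :: "cmat4 set" where
  "cone_set = {(\<chi> i j. c * M $ i $ j) | c M. M \<in> O4}"

definition zariski_closure :: "cmat4 set \<Rightarrow> cmat4 set" where
  "zariski_closure S = {x. \<forall>f\<in>poly_fns. (\<forall>y\<in>S. f y = 0) \<longrightarrow> f x = 0}"

definition cone_O4 :: "cmat4 set" where
  "cone_O4 = zariski_closure cone_set"

text \<open>Degree-d component of the coordinate ring of V (V a cone): the restrictions to V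
  of the homogeneous degree-d polynomials (i.e. degree-d polynomials modulo the
  degree-d part of the vanishing ideal), as functions V -> C (zero outside V).\<close>
definition coord_ring_deg :: "cmat4 set \<Rightarrow> nat \<Rightarrow> (cmat4 \<Rightarrow> complex) set" where
  "coord_ring_deg V d = {(\<lambda>x. if x \<in> V then f x else 0) | f. f \<in> hom_poly_fns d}"

definition hilb_coeff :: "cmat4 set \<Rightarrow> nat \<Rightarrow> nat" where
  "hilb_coeff V d = vector_space.dim fscale (coord_ring_deg V d)"

definition hilbert_series :: "cmat4 set \<Rightarrow> real fps" where
  "hilbert_series V = Abs_fps (\<lambda>d. real (hilb_coeff V d))"

end

theory Submission
  imports Defs "HOL-Library.Multiset"
begin

text \<open>
  Identify \<open>\<complex>\<^sup>4\<close> with the 2 by 2 matrices, the determinant being the standard quadratic form. The cone over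
  SO(4) then consists of the maps \<open>X \<mapsto> p X q\<^sup>T\<close> and the cone over the other component of O(4) of the maps
  \<open>X \<mapsto> p X\<^sup>T q\<^sup>T\<close>: in suitable coordinates \<open>y\<^sub>a\<^sub>b\<^sub>c\<^sub>d\<close> on the 4 by 4 matrices these are the tensors
  \<open>p\<^sub>a\<^sub>c q\<^sub>b\<^sub>d\<close> and \<open>p\<^sub>a\<^sub>d q\<^sub>b\<^sub>c\<close>. A monomial of degree \<open>d\<close> in the \<open>y\<close> restricts to a monomial in \<open>p, q\<close>
  on each component, hence is an edge of a bipartite graph with two copies of the set of pairs
  (monomial of degree \<open>d\<close> in \<open>p\<close>, monomial of degree \<open>d\<close> in \<open>q\<close>) as vertices. The degree \<open>d\<close> part of the
  coordinate ring is spanned by the edge vectors, so its dimension is the number of vertices,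
  2 binom(d+3,3)^2, minus the number of connected components. The total degrees in the four indices
  a, b, c, d are constant on components and separate them, which gives (d+1)^4 components, except that
  for d = 2 one of the classes splits in two.
\<close>

section \<open>Linear algebra\<close>

text \<open>Read \<open>U\<close> and \<open>W\<close> as the two sides of a bipartite graph with edge set \<open>E\<close>, the fibres of the labelling
  being the connected components.\<close>
lemma (in vector_space) dim_span_edges:
  fixes e :: "'u \<Rightarrow> 'b" and e' :: "'w \<Rightarrow> 'b"
  assumes fin: "finite U" "finite W"
    and inj: "inj_on e U" "inj_on e' W" "e ` U \<inter> e' ` W = {}"
    and indep: "independent (e ` U \<union> e' ` W)"
    and E: "E \<subseteq> U \<times> W"
    and lab: "\<And>u w. (u, w) \<in> E \<Longrightarrow> lab u = lab' w"
    and cover: "\<And>w. w \<in> W \<Longrightarrow> \<exists>u. (u, w) \<in> E"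
    and conn: "\<And>u v. u \<in> U \<Longrightarrow> v \<in> U \<Longrightarrow> lab u = lab v \<Longrightarrow>
                 e u - e v \<in> span ((\<lambda>(u, w). e u + e' w) ` E)"
  shows "dim ((\<lambda>(u, w). e u + e' w) ` E) + card (lab ` U) = card U + card W"
proof -
  define S where "S = (\<lambda>(u, w). e u + e' w) ` E"
  define r where "r = inv_into U lab"
  define R where "R = r ` lab ` U"
  have rU: "r (lab u) \<in> U" and rl: "lab (r (lab u)) = lab u" if "u \<in> U" for u
    using that by (auto simp: r_def inv_into_into f_inv_into_f)
  have RU: "R \<subseteq> U" using rU by (auto simp: R_def)
  have "inj_on r (lab ` U)" by (simp add: r_def inj_on_inv_into)
  hence cR: "card R = card (lab ` U)" by (simp add: R_def card_image)
  have rR: "r (lab u) = u" if "u \<in> R" for u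
    using that rl by (auto simp: R_def)
  have finR: "finite R" using RU fin finite_subset by blast
  have finE: "finite E" using E fin finite_subset by blast
  have finS: "finite S" by (simp add: S_def finE)
  \<comment> \<open>Upper bound: every edge vector is a difference to the chosen representative of
    its class plus a vector attached to its end in \<open>W\<close>. The differences vanish on
    \<open>R\<close>, so omitting them leaves at most \<open>card U - card R + card W\<close>
    spanning vectors.\<close>
  define T where "T = (\<lambda>u. e u - e (r (lab u))) ` (U - R) \<union> (\<lambda>w. e' w + e (r (lab' w))) ` W"
  have finT: "finite T" by (simp add: T_def fin)
  have "S \<subseteq> span T"
  proof
    fix x assume "x \<in> S"
    then obtain u w where uw: "(u, w) \<in> E" and x: "x = e u + e' w" by (auto simp: S_def)
    have u: "u \<in> U" and w: "w \<in> W" using uw E by auto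
    have "e u - e (r (lab u)) \<in> span T"
    proof (cases "u \<in> R")
      case True
      then show ?thesis by (simp add: rR span_zero)
    next
      case False
      then show ?thesis using u by (auto simp: T_def intro!: span_base)
    qed
    moreover have "e' w + e (r (lab' w)) \<in> span T"
      using w by (auto simp: T_def intro!: span_base)
    moreover have "x = (e u - e (r (lab u))) + (e' w + e (r (lab' w)))"
      using lab[OF uw] x by simp
    ultimately show "x \<in> span T" by (metis span_add)
  qed
  hence "dim S \<le> card T" by (rule dim_le_card[OF _ finT])
  also have "\<dots> \<le> card (U - R) + card W"
    unfolding T_def by (intro order.trans[OF card_Un_le] add_mono card_image_le) (use fin in auto)
  also have "card (U - R) = card U - card R" by (rule card_Diff_subset[OF finR RU])
  finally have upper: "dim S + card (lab ` U) \<le> card U + card W"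
    using card_mono[OF fin(1) RU] cR by linarith
  \<comment> \<open>Lower bound: a basis of the edges together with the representatives reaches
    every vertex of \<open>U\<close> by \<open>conn\<close>, and then every vertex of
    \<open>W\<close> along an edge.\<close>
  obtain B where B: "B \<subseteq> S" "independent B" "S \<subseteq> span B" "card B = dim S"
    using basis_exists by blast
  have finB: "finite B" using B finS finite_subset by blast
  have SB: "span S \<subseteq> span (B \<union> e ` R)"
    using B by (metis span_minimal subspace_span subset_trans span_mono sup_ge1)
  have eU: "e u \<in> span (B \<union> e ` R)" if "u \<in> U" for u
  proof -
    have "e u - e (r (lab u)) \<in> span (B \<union> e ` R)"
      using conn[OF that rU[OF that]] rl[OF that] SB by (auto simp: S_def)
    moreover have "e (r (lab u)) \<in> span (B \<union> e ` R)"
      using that by (auto intro!: span_base simp: R_def)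
    ultimately show ?thesis using span_add by fastforce
  qed
  have "e ` U \<union> e' ` W \<subseteq> span (B \<union> e ` R)"
  proof -
    have "e' w \<in> span (B \<union> e ` R)" if w: "w \<in> W" for w
    proof -
      obtain u where u: "(u, w) \<in> E" using cover[OF w] by blast
      have "e u + e' w \<in> span (B \<union> e ` R)"
        using u by (intro subsetD[OF SB] span_base) (force simp: S_def)
      moreover have "e u \<in> span (B \<union> e ` R)" using eU u E by auto
      ultimately show ?thesis using span_diff by fastforce
    qed
    with eU show ?thesis by auto
  qed
  hence "card (e ` U \<union> e' ` W) \<le> card (B \<union> e ` R)"
    using independent_span_bound[OF _ indep] finB finR by auto
  also have "\<dots> \<le> card B + card R"
    by (intro order.trans[OF card_Un_le] add_mono card_image_le) (use finR in auto)
  also have "card (e ` U \<union> e' ` W) = card U + card W"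
    using inj fin by (subst card_Un_disjoint) (auto simp: card_image)
  finally show ?thesis using upper B(4) cR unfolding S_def by linarith
qed

text \<open>Lift a basis of the image under \<open>f\<close> to a subset \<open>C\<close> of
  \<open>H\<close>. Equal kernels make \<open>g\<close> injective on the span of \<open>C\<close>,
  and every element of \<open>H\<close> differs from this span by a kernel element, so
  \<open>g\<close> sends \<open>C\<close> to a basis of its own image. This allows restriction to
  the cone to be replaced by pullback along a parametrisation.\<close>

lemma (in vector_space_pair) dim_image_eq_of_kernel_eq:
  assumes A: "Vector_Spaces.linear s1 s2 f" and H: "vs1.subspace H" and B: "Vector_Spaces.linear s1 s3 g"
    and vs: "vector_space s3"
    and ker: "\<And>x. x \<in> H \<Longrightarrow> f x = 0 \<longleftrightarrow> g x = 0"
  shows "vs2.dim (f ` H) = vector_space.dim s3 (g ` H)"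
proof -
  interpret vs3: vector_space s3 by fact
  interpret p: vector_space_pair s1 s3 by unfold_locales
  obtain T where T: "T \<subseteq> f ` H" "vs2.independent T" "f ` H \<subseteq> vs2.span T" "card T = vs2.dim (f ` H)"
    using vs2.basis_exists by blast
  obtain C where C: "C \<subseteq> H" "inj_on f C" "f ` C = T"
    using T(1) by (metis subset_image_inj)
  have spC: "vs1.span C \<subseteq> H" using C(1) H by (rule vs1.span_minimal)
  have "vs2.independent (f ` C)" using T(2) C(3) by simp
  hence injf: "inj_on f (vs1.span C)"
    using linear_inj_on_span_independent_image[OF A _ C(2)] by blast
  have "inj_on g (vs1.span C)"
    unfolding p.linear_inj_on_iff_eq_0[OF B vs1.subspace_span]
  proof safe
    fix x assume x: "x \<in> vs1.span C" "g x = 0"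
    hence "f x = 0" using ker spC by blast
    thus "x = 0" using injf x(1) unfolding linear_inj_on_iff_eq_0[OF A vs1.subspace_span] by blast
  qed
  moreover have "vs1.independent C"
  proof
    assume "vs1.dependent C"
    then obtain a where a: "a \<in> C" "a \<in> vs1.span (C - {a})" by (auto simp: vs1.dependent_def)
    hence "f a \<in> vs2.span (f ` (C - {a}))" using linear_span_image[OF A] by blast
    moreover have "f ` (C - {a}) = T - {f a}" using C a(1) by (auto simp: inj_on_def)
    ultimately show False using T(2) C(3) a(1) by (auto simp: vs2.dependent_def)
  qed
  ultimately have "vs3.independent (g ` C)"
    by (intro p.linear_independent_injective_image[OF B])
  moreover have "g ` H \<subseteq> vs3.span (g ` C)"
  proof safe
    fix x assume x: "x \<in> H"
    have "f x \<in> f ` vs1.span C"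
      using T(3) x C(3) linear_span_image[OF A, of C] by auto
    then obtain c where c: "c \<in> vs1.span C" "f x = f c" by blast
    have "x - c \<in> H" using x c spC H vs1.subspace_diff by blast
    moreover have "f (x - c) = 0" using c linear_diff[OF A] by simp
    ultimately have "g (x - c) = 0" using ker by blast
    hence "g x = g c" using p.linear_diff[OF B] by simp
    thus "g x \<in> vs3.span (g ` C)" using c p.linear_span_image[OF B, of C] by auto
  qed
  ultimately have "card (g ` C) = vs3.dim (g ` H)"
    using C(1) by (intro vs3.basis_card_eq_dim) auto
  moreover have "card (g ` C) = card C"
    using \<open>inj_on g (vs1.span C)\<close> by (meson card_image inj_on_subset vs1.span_superset)
  moreover have "card C = card T" using C by (metis card_image)
  ultimately show ?thesis using T(4) by simp
qed

lemma (in vector_space) independent_family: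
  assumes "finite J"
    and zero: "\<And>c j. (\<Sum>j\<in>J. scale (c j) (V j)) = 0 \<Longrightarrow> j \<in> J \<Longrightarrow> c j = 0"
  shows "inj_on V J" "independent (V ` J)"
proof -
  show inj: "inj_on V J"
  proof (rule inj_onI, rule ccontr)
    fix i j assume ij: "i \<in> J" "j \<in> J" "V i = V j" "i \<noteq> j"
    define c where "c k = (if k = i then 1 else if k = j then -1 else 0 :: 'a)" for k
    have "(\<Sum>k\<in>J. scale (c k) (V k)) = (\<Sum>k\<in>{i, j}. scale (c k) (V k))"
      using ij assms(1) by (intro sum.mono_neutral_right) (auto simp: c_def)
    also have "\<dots> = 0" using ij by (simp add: c_def)
    finally have "c i = 0" using zero ij(1) by blast
    thus False by (simp add: c_def)
  qed
  show "independent (V ` J)"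
  proof (rule independent_if_scalars_zero)
    show "finite (V ` J)" using assms(1) by simp
    fix f x assume "(\<Sum>x\<in>V ` J. scale (f x) x) = 0" "x \<in> V ` J"
    moreover have "(\<Sum>x\<in>V ` J. scale (f x) x) = (\<Sum>j\<in>J. scale (f (V j)) (V j))"
      by (simp add: sum.reindex[OF inj])
    ultimately show "f x = 0" using zero[of "\<lambda>j. f (V j)"] by auto
  qed
qed

section \<open>Complex functions, characters and monomials\<close>

interpretation fun_vs: vector_space "fscale :: complex \<Rightarrow> ('a \<Rightarrow> complex) \<Rightarrow> 'a \<Rightarrow> complex"
  by unfold_locales (auto simp: fscale_def algebra_simps)

lemma fscale_apply: "fscale c f x = c * f x"
  by (simp add: fscale_def)

text \<open>Subtracting \<open>ch j y\<close> times the relation at \<open>x\<close> from the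
  relation at \<open>y * x\<close> removes the character \<open>ch j\<close>; induction applies to
  the shorter relation, with \<open>y\<close> chosen to separate \<open>ch k\<close> from
  \<open>ch j\<close>. Evaluation at 1 then settles \<open>c j\<close>.\<close>

lemma Dedekind_independence:
  fixes ch :: "'i \<Rightarrow> 'g::monoid_mult \<Rightarrow> complex"
  assumes "finite I" and "inj_on ch I"
    and "\<And>i. i \<in> I \<Longrightarrow> ch i 1 = 1"
    and mult: "\<And>i x y. i \<in> I \<Longrightarrow> ch i (x * y) = ch i x * ch i y"
    and "\<And>x. (\<Sum>i\<in>I. c i * ch i x) = 0" and "i \<in> I"
  shows "c i = 0"
  using assms
proof (induction I arbitrary: c i rule: finite_induct)
  case (insert j I)
  have inj: "inj_on ch I" using insert.prems(1) by auto
  have s: "c j * ch j x + (\<Sum>i\<in>I. c i * ch i x) = 0" for x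
    using insert.prems(4)[of x] insert.hyps by simp
  have s': "(\<Sum>i\<in>I. c i * ch i x) = - (c j * ch j x)" for x
    using s[of x] by (simp add: add_eq_0_iff)
  have zI: "c k = 0" if k: "k \<in> I" for k
  proof -
    have "ch k \<noteq> ch j" using insert.prems(1) insert.hyps k by (auto simp: inj_on_def)
    then obtain y where y: "ch k y \<noteq> ch j y" by blast
    have "(\<Sum>i\<in>I. (c i * (ch i y - ch j y)) * ch i x) = 0" for x
    proof -
      have "(\<Sum>i\<in>I. (c i * (ch i y - ch j y)) * ch i x)
          = (\<Sum>i\<in>I. c i * ch i (y * x)) - ch j y * (\<Sum>i\<in>I. c i * ch i x)"
        by (simp add: sum_distrib_left sum_subtractf [symmetric] insert.prems(3) algebra_simps)
      also have "\<dots> = (ch j y * (c j * ch j x)) - c j * ch j (y * x)"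
        by (simp add: s')
      also have "\<dots> = 0" by (simp add: insert.prems(3))
      finally show ?thesis .
    qed
    hence "c k * (ch k y - ch j y) = 0"
      using insert.IH[OF inj, of "\<lambda>i. c i * (ch i y - ch j y)" k] insert.prems k by auto
    with y show ?thesis by simp
  qed
  with s[of 1] insert.prems(2)[of j] have "c j = 0" by simp
  with zI insert.prems(5) show ?case by auto
qed simp

text \<open>Multisets of variables replace exponent vectors, so that degree is \<open>size\<close>
  and regrouping indices is \<open>image_mset\<close>. The target is a general commutative monoid in
  order to cover both values of monomials and monomials as functions.\<close>

definition mset_monom :: "('i \<Rightarrow> 'r::comm_monoid_mult) \<Rightarrow> 'i multiset \<Rightarrow> 'r" where
  "mset_monom g X = prod_mset (image_mset g X)"

lemma mset_monom_simps [simp]: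
  "mset_monom g {#} = 1"
  "mset_monom g (add_mset x X) = g x * mset_monom g X"
  "mset_monom g (X + Y) = mset_monom g X * mset_monom g Y"
  by (simp_all add: mset_monom_def)

lemma mset_monom_apply: "mset_monom g X z = mset_monom (\<lambda>x. g x z) X"
  by (induction X) auto

lemma mset_monom_mult: "mset_monom (p * p') X = mset_monom p X * mset_monom p' X"
  by (induction X) (auto simp: algebra_simps)

lemma mset_monom_one: "mset_monom 1 X = 1"
  by (induction X) auto

lemma mset_monom_indicator:
  "mset_monom (\<lambda>y. if y = x then (2::complex) else 1) X = 2 ^ count X x"
  by (induction X) auto

lemma span_mult:
  assumes "f \<in> fun_vs.span A" "g \<in> fun_vs.span B"
    and AB: "\<And>a b. a \<in> A \<Longrightarrow> b \<in> B \<Longrightarrow> a * b \<in> fun_vs.span C"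
  shows "f * g \<in> fun_vs.span C"
proof -
  have 1: "a * g \<in> fun_vs.span C" if a: "a \<in> A" for a
    using assms(2)
  proof (induction rule: fun_vs.span_induct_alt)
    case base
    show ?case by (metis mult_zero_right fun_vs.span_zero)
  next
    case (step c x y)
    have "a * (fscale c x + y) = fscale c (a * x) + a * y"
      by (auto simp: fscale_def algebra_simps)
    then show ?case using AB[OF a step(1)] step(2)
      by (metis fun_vs.span_add fun_vs.span_scale)
  qed
  show ?thesis
    using assms(1)
  proof (induction rule: fun_vs.span_induct_alt)
    case base
    show ?case by (metis mult_zero_left fun_vs.span_zero)
  next
    case (step c x y)
    have "(fscale c x + y) * g = fscale c (x * g) + y * g"
      by (auto simp: fscale_def algebra_simps)
    then show ?case using 1[OF step(1)] step(2)
      by (metis fun_vs.span_add fun_vs.span_scale)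
  qed
qed

text \<open>Expanding a product of linear forms yields only monomials of the same degree. Used in
  both directions, this makes the graded pieces independent of the choice of linear
  coordinates.\<close>

lemma mset_monom_in_span:
  fixes g :: "'i \<Rightarrow> 'z \<Rightarrow> complex" and h :: "'j \<Rightarrow> 'z \<Rightarrow> complex"
  assumes "\<And>i. g i \<in> fun_vs.span (range h)"
  shows "mset_monom g X \<in> fun_vs.span {mset_monom h Y | Y. size Y = size X}"
proof (induction X)
  case empty
  show ?case by (auto intro!: fun_vs.span_base)
next
  case (add x X)
  show ?case unfolding mset_monom_simps
  proof (rule span_mult[OF assms add.IH])
    fix a b assume "a \<in> range h" "b \<in> {mset_monom h Y | Y. size Y = size X}"
    then obtain y Y where "a = h y" "b = mset_monom h Y" "size Y = size X" by auto
    hence "a * b = mset_monom h (add_mset y Y)" "size (add_mset y Y) = size (add_mset x X)" by auto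
    thus "a * b \<in> fun_vs.span {mset_monom h Y |Y. size Y = size (add_mset x X)}"
      by (metis (mono_tags, lifting) fun_vs.span_base mem_Collect_eq)
  qed
qed

section \<open>The bipartite graph of monomials\<close>

text \<open>A point \<open>(s, p, q)\<close> parametrises the rank one tensor with coordinates \<open>p\<^sub>a\<^sub>c q\<^sub>b\<^sub>d\<close> if \<open>s\<close> holds
  (component of SO(4)) and \<open>p\<^sub>a\<^sub>d q\<^sub>b\<^sub>c\<close> otherwise. Tensor coordinates are indexed by \<open>((a, c), (b, d))\<close>.\<close>

type_synonym bits = "bool \<times> bool"
type_synonym param = "bool \<times> (bits \<Rightarrow> complex) \<times> (bits \<Rightarrow> complex)"

definition twist :: "bits \<times> bits \<Rightarrow> bits \<times> bits" where
  "twist x = ((fst (fst x), snd (snd x)), (fst (snd x), snd (fst x)))"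

lemma twist_simp [simp]: "twist ((a, c), (b, d)) = ((a, d), (b, c))"
  by (simp add: twist_def)

lemma twist_twist [simp]: "twist (twist x) = x"
  by (simp add: twist_def)

definition vert :: "bool \<Rightarrow> bits multiset \<times> bits multiset \<Rightarrow> param \<Rightarrow> complex" where
  "vert s u z = (if fst z = s then mset_monom (fst (snd z)) (fst u) * mset_monom (snd (snd z)) (snd u) else 0)"

definition ycoord :: "bits \<times> bits \<Rightarrow> param \<Rightarrow> complex" where
  "ycoord x z = (let x' = (if fst z then x else twist x) in fst (snd z) (fst x') * snd (snd z) (snd x'))"

text \<open>The two margins of a table. On pairs of pairs they are the monomials in \<open>p\<close>
  and \<open>q\<close>; on pairs of bits they record the degrees in the two indices.\<close>

definition proj :: "('a \<times> 'b) multiset \<Rightarrow> 'a multiset \<times> 'b multiset" where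
  "proj X = (image_mset fst X, image_mset snd X)"

lemma proj_simps [simp]:
  "proj {#} = ({#}, {#})"
  "proj (add_mset x X) = (add_mset (fst x) (fst (proj X)), add_mset (snd x) (snd (proj X)))"
  "proj (X + Y) = (fst (proj X) + fst (proj Y), snd (proj X) + snd (proj Y))"
  by (simp_all add: proj_def)

abbreviation proj' :: "(bits \<times> bits) multiset \<Rightarrow> bits multiset \<times> bits multiset" where
  "proj' X \<equiv> proj (image_mset twist X)"

text \<open>On either component each coordinate is one variable of \<open>p\<close> times one of
  \<open>q\<close>, so a monomial in the coordinates is the edge from \<open>proj X\<close> to
  \<open>proj' X\<close>.\<close>

lemma mset_monom_ycoord:
  "mset_monom ycoord X = vert True (proj X) + vert False (proj' X)"
proof
  fix z :: param
  obtain s p q where z: "z = (s, p, q)" by (cases z) auto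
  show "mset_monom ycoord X z = (vert True (proj X) + vert False (proj' X)) z"
    by (induction X) (auto simp: mset_monom_apply z vert_def ycoord_def Let_def)
qed

lemma proj_surj:
  "size P = size Q \<Longrightarrow> \<exists>X. proj X = (P, Q) \<and> size X = size P"
proof (induction P arbitrary: Q)
  case empty
  then show ?case by (auto intro!: exI[of _ "{#}"])
next
  case (add x P)
  then obtain y Q' where Q: "Q = add_mset y Q'" by (metis size_Suc_Diff1 multi_nonempty_split size_empty size_eq_0_iff_empty add_mset_not_empty)
  with add obtain X where "proj X = (P, Q')" "size X = size P" by auto
  then show ?case using Q by (auto intro!: exI[of _ "add_mset (x, y) X"])
qed

lemma size_proj: "proj X = (P, Q) \<Longrightarrow> size P = size X \<and> size Q = size X"
  by (auto simp: proj_def)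

text \<open>Two edges with a common end on the \<open>False\<close> side: one step of a walk among
  the vertices of the \<open>True\<close> side.\<close>

definition linked where
  "linked u v \<longleftrightarrow> (\<exists>X Y. proj X = u \<and> proj Y = v \<and> proj' X = proj' Y)"

text \<open>Exchanging \<open>p\<close> and \<open>q\<close> commutes with \<open>twist\<close> and
  is therefore a symmetry of the graph.\<close>

lemma linked_swap: "linked (P, Q) (P', Q') \<Longrightarrow> linked (Q, P) (Q', P')"
proof -
  assume "linked (P, Q) (P', Q')"
  then obtain X Y where X: "proj X = (P, Q)" "proj Y = (P', Q')" "proj' X = proj' Y"
    by (auto simp: linked_def)
  have *: "proj (image_mset prod.swap Z) = prod.swap (proj Z)" for Z :: "(bits \<times> bits) multiset"
    by (simp add: proj_def multiset.map_comp comp_def)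
  have "twist (prod.swap x) = prod.swap (twist x)" for x
    by (simp add: twist_def)
  hence **: "proj' (image_mset prod.swap Z) = prod.swap (proj' Z)" for Z
    unfolding *[symmetric] by (simp add: multiset.map_comp comp_def)
  show ?thesis
    unfolding linked_def
    by (rule exI[of _ "image_mset prod.swap X"], rule exI[of _ "image_mset prod.swap Y"])
       (simp only: * ** X, simp)
qed

section \<open>Moves between multisets with equal margins\<close>

definition swaps :: "bits multiset \<Rightarrow> bits multiset \<Rightarrow> bool" where
  "swaps P P' \<longleftrightarrow> (\<exists>a c R. P = add_mset (a, c) (add_mset (\<not>a, \<not>c) R) \<and>
     P' = add_mset (a, \<not>c) (add_mset (\<not>a, c) R))"

lemma swaps_add: "swaps\<^sup>*\<^sup>* P P' \<Longrightarrow> swaps\<^sup>*\<^sup>* (add_mset x P) (add_mset x P')"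
proof (induction rule: rtranclp_induct)
  case (step y z)
  have "swaps (add_mset x y) (add_mset x z)"
  proof -
    from step(2) obtain a c R where "y = add_mset (a, c) (add_mset (\<not>a, \<not>c) R)"
      "z = add_mset (a, \<not>c) (add_mset (\<not>a, c) R)" by (auto simp: swaps_def)
    thus ?thesis unfolding swaps_def
      by (intro exI[of _ a] exI[of _ c] exI[of _ "add_mset x R"]) (auto simp: add_mset_commute)
  qed
  with step show ?case by auto
qed simp

lemma swaps_proj: "swaps P P' \<Longrightarrow> proj P = proj P'"
  by (auto simp: swaps_def add_mset_commute)

text \<open>Swaps are the basic moves of 2 by 2 contingency tables with fixed margins. A common
  element can be removed by induction. If \<open>(a, c)\<close> is missing from \<open>P'\<close>,
  the margins force both of its neighbours in row \<open>a\<close> and column \<open>c\<close> to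
  occur there, and one swap makes \<open>(a, c)\<close> appear.\<close>

lemma proj_eq_imp_swaps: "proj P = proj P' \<Longrightarrow> swaps\<^sup>*\<^sup>* P P'"
proof (induction P arbitrary: P')
  case empty
  then show ?case by (auto simp: proj_def)
next
  case (add x P)
  have share: "swaps\<^sup>*\<^sup>* (add_mset x P) Q" if "x \<in># Q" "proj Q = proj (add_mset x P)" for Q
  proof -
    from that obtain Q' where Q: "Q = add_mset x Q'" by (meson multi_member_split)
    with that have "proj P = proj Q'" by (auto simp: proj_def)
    with add.IH have "swaps\<^sup>*\<^sup>* P Q'" by auto
    thus ?thesis using swaps_add Q by blast
  qed
  show ?case
  proof (cases "x \<in># P'")
    case True
    then show ?thesis using share add.prems by simp
  next
    case False
    obtain a c where x: "x = (a, c)" by (cases x)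
    have "image_mset fst P' = add_mset a (image_mset fst P)" "image_mset snd P' = add_mset c (image_mset snd P)"
      using add.prems by (simp_all add: proj_def x)
    hence "a \<in># image_mset fst P'" "c \<in># image_mset snd P'" by (metis union_single_eq_member)+
    then obtain y z where y: "y \<in># P'" "fst y = a" and z: "z \<in># P'" "snd z = c" by auto
    have "y \<noteq> x" "z \<noteq> x" using y z False by auto
    hence yz: "y = (a, \<not>c)" "z = (\<not>a, c)" using y z x by (simp_all add: prod_eq_iff)
    hence "y \<noteq> z" by auto
    then obtain R where R: "P' = add_mset y (add_mset z R)"
      using y z by (metis insert_DiffM insert_noteq_member)
    let ?Q = "add_mset (a, c) (add_mset (\<not>a, \<not>c) R)"
    have sw: "swaps ?Q P'" unfolding swaps_def R yz by blast
    moreover have "swaps\<^sup>*\<^sup>* (add_mset x P) ?Q"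
    proof (rule share)
      show "x \<in># ?Q" by (simp add: x)
      show "proj ?Q = proj (add_mset x P)" using swaps_proj[OF sw] add.prems by (rule trans[OF _ sym])
    qed
    ultimately show ?thesis by auto
  qed
qed

text \<open>If \<open>Q\<close> is repetitive, every swap in \<open>P\<close> is realised by two edges through a common vertex.\<close>
definition repetitive :: "bits multiset \<Rightarrow> bool" where
  "repetitive Q \<longleftrightarrow> (\<exists>x y S. Q = add_mset x (add_mset y S) \<and> (fst x = fst y \<or> snd x = snd y))"

text \<open>These are the diagonal and the antidiagonal of the 2 by 2 table, the only multisets of
  size 2 that are not repetitive. Phrasing this through the margins shows that it depends on them
  alone.\<close>

definition mixed :: "bits multiset \<Rightarrow> bool" where
  "mixed Q \<longleftrightarrow> proj Q = ({#False, True#}, {#False, True#})"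

text \<open>Pair the two swapped elements of \<open>P\<close> with \<open>x\<close> and
  \<open>y\<close>. After \<open>twist\<close>, the second bits of \<open>P\<close> sit next to the
  first bits of \<open>Q\<close> and conversely; if a bit of \<open>Q\<close> is repeated,
  exchanging the two bits of \<open>P\<close> beside it is invisible on the other side.\<close>

lemma linked_if_swaps:
  assumes "swaps P P'" "repetitive Q" "size P = size Q"
  shows "linked (P, Q) (P', Q)"
proof -
  obtain a c R where P: "P = add_mset (a, c) (add_mset (\<not>a, \<not>c) R)"
     "P' = add_mset (a, \<not>c) (add_mset (\<not>a, c) R)" using assms by (auto simp: swaps_def)
  obtain x y S where Q: "Q = add_mset x (add_mset y S)" and xy: "fst x = fst y \<or> snd x = snd y"
    using assms by (auto simp: repetitive_def)
  obtain Y where Y: "proj Y = (R, S)" using proj_surj[of R S] P Q assms(3) by auto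
  obtain b d b' d' where x: "x = (b, d)" and y: "y = (b', d')" by (cases x; cases y)
  from xy show ?thesis
  proof
    assume "fst x = fst y"
    thus ?thesis unfolding linked_def
      by (intro exI[of _ "add_mset ((a, c), x) (add_mset ((\<not>a, \<not>c), y) Y)"]
                exI[of _ "add_mset ((a, \<not>c), x) (add_mset ((\<not>a, c), y) Y)"])
         (auto simp: P Q Y x y add_mset_commute)
  next
    assume "snd x = snd y"
    thus ?thesis unfolding linked_def
      by (intro exI[of _ "add_mset ((a, c), x) (add_mset ((\<not>a, \<not>c), y) Y)"]
                exI[of _ "add_mset ((\<not>a, c), x) (add_mset ((a, \<not>c), y) Y)"])
         (auto simp: P Q Y x y add_mset_commute)
  qed
qed

lemma linked_if_proj_eq:
  assumes "proj P = proj P'" "repetitive Q" "size P = size Q"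
  shows "linked\<^sup>*\<^sup>* (P, Q) (P', Q)" "linked\<^sup>*\<^sup>* (Q, P) (Q, P')"
proof -
  have "swaps\<^sup>*\<^sup>* P P'" by (rule proj_eq_imp_swaps[OF assms(1)])
  hence "linked\<^sup>*\<^sup>* (P, Q) (P', Q) \<and> linked\<^sup>*\<^sup>* (Q, P) (Q, P') \<and> size P' = size Q"
  proof (induction rule: rtranclp_induct)
    case base
    then show ?case using assms by simp
  next
    case (step y z)
    have "linked (y, Q) (z, Q)" using linked_if_swaps step assms by blast
    moreover from this have "linked (Q, y) (Q, z)" by (rule linked_swap)
    moreover have "size z = size y" using swaps_proj[OF step(2)] by (metis size_proj surj_pair)
    ultimately show ?case using step by (metis rtranclp.rtrancl_into_rtrancl)
  qed
  thus "linked\<^sup>*\<^sup>* (P, Q) (P', Q)" "linked\<^sup>*\<^sup>* (Q, P) (Q, P')" by auto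
qed

text \<open>Pigeonhole: among three bits two agree.\<close>

lemma repetitive_if_size_ge_3:
  assumes "size Q \<ge> 3"
  shows "repetitive Q"
proof -
  obtain x Q1 where 1: "Q = add_mset x Q1" using assms by (cases Q) auto
  obtain y Q2 where 2: "Q1 = add_mset y Q2" using assms 1 by (cases Q1) auto
  obtain z S where 3: "Q2 = add_mset z S" using assms 1 2 by (cases Q2) auto
  consider "fst x = fst y" | "fst x = fst z" | "fst y = fst z" by auto
  thus ?thesis
  proof cases
    case 1
    then show ?thesis using \<open>Q = _\<close> 2 3 unfolding repetitive_def by blast
  next
    case 2
    have "Q = add_mset x (add_mset z (add_mset y S))"
      using \<open>Q = _\<close> \<open>Q1 = _\<close> 3 by (simp add: add_mset_commute)
    then show ?thesis using 2 unfolding repetitive_def by blast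
  next
    case 3
    have "Q = add_mset y (add_mset z (add_mset x S))"
      using \<open>Q = _\<close> \<open>Q1 = _\<close> \<open>Q2 = _\<close> by (simp add: add_mset_commute)
    then show ?thesis using 3 unfolding repetitive_def by blast
  qed
qed

section \<open>The exceptional degree two\<close>

lemma size_2_mset:
  assumes "size Q = 2"
  shows "\<exists>x y. Q = {#x, y#}"
proof -
  obtain x R where R: "Q = add_mset x R" using assms by (cases Q) auto
  obtain y S where "R = add_mset y S" using assms R by (cases R) auto
  with R assms show ?thesis by auto
qed

lemma mset_bool_2: "{#a, b#} = {#False, True#} \<longleftrightarrow> b = (\<not> a)"
  by (cases a; cases b; simp add: add_mset_commute)

lemma mixed_iff: "mixed Q \<longleftrightarrow> (\<exists>c. Q = {#(False, c), (True, \<not>c)#})"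
proof
  assume m: "mixed Q"
  hence "size Q = 2" using size_proj unfolding mixed_def by fastforce
  then obtain x y where Q: "Q = {#x, y#}" using size_2_mset by blast
  with m have "fst y = (\<not> fst x)" "snd y = (\<not> snd x)" by (auto simp: mixed_def mset_bool_2)
  then obtain a c where xy: "x = (a, c)" "y = (\<not> a, \<not> c)" by (cases x; cases y) auto
  thus "\<exists>c. Q = {#(False, c), (True, \<not>c)#}"
  proof (cases a)
    case True
    then have "Q = {#(False, \<not>c), (True, \<not>\<not>c)#}" using Q xy by (simp add: add_mset_commute)
    then show ?thesis by blast
  next
    case False
    then show ?thesis using Q xy by auto
  qed
next
  assume "\<exists>c. Q = {#(False, c), (True, \<not>c)#}"
  thus "mixed Q" by (auto simp: mixed_def mset_bool_2)
qed

lemma mixed_2: "mixed {#x, y#} \<longleftrightarrow> y = (\<not> fst x, \<not> snd x)"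
  by (cases x; cases y) (auto simp: mixed_def mset_bool_2)

lemma repetitive_or_mixed:
  assumes "size Q = 2"
  shows "repetitive Q \<or> mixed Q"
proof -
  obtain x y where Q: "Q = {#x, y#}" using size_2_mset assms by blast
  show ?thesis
  proof (cases "fst x = fst y \<or> snd x = snd y")
    case True
    then show ?thesis unfolding Q repetitive_def by blast
  next
    case False
    then show ?thesis unfolding Q mixed_2 by (simp add: prod_eq_iff)
  qed
qed

lemma swaps_size_2: "swaps P P' \<Longrightarrow> size P \<le> 2 \<Longrightarrow> mixed P"
  unfolding swaps_def by (elim exE conjE) (simp add: mixed_2)

text \<open>In size at most 2 a swap can start only from a mixed multiset, so the chain of swaps
  from \<open>P\<close> has length zero.\<close>

lemma proj_eq_imp_eq:
  assumes "proj P = proj P'" "size P \<le> 2" "\<not> mixed P"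
  shows "P = P'"
  using proj_eq_imp_swaps[OF assms(1)]
proof (cases rule: converse_rtranclpE)
  case (step y)
  then show ?thesis using swaps_size_2 assms by blast
qed

text \<open>When both factors are mixed, neither is repetitive and single swaps are not provided by
  \<open>linked_if_swaps\<close>. Swapping both factors at once is still a link, and it preserves
  the parity below.\<close>

lemma linked_mixed:
  "linked ({#(False, c), (True, \<not>c)#}, {#(False, d), (True, \<not>d)#})
          ({#(False, \<not>c), (True, c)#}, {#(False, \<not>d), (True, d)#})"
proof -
  let ?X = "{#((False, c), (False, d)), ((True, \<not>c), (True, \<not>d))#}"
  let ?Y = "{#((False, \<not>c), (True, d)), ((True, c), (False, \<not>d))#}"
  have "proj ?X = ({#(False, c), (True, \<not>c)#}, {#(False, d), (True, \<not>d)#})" by simp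
  moreover have "proj ?Y = ({#(False, \<not>c), (True, c)#}, {#(False, \<not>d), (True, d)#})"
    by (simp add: add_mset_commute)
  moreover have "proj' ?X = proj' ?Y" by (simp add: add_mset_commute)
  ultimately show ?thesis unfolding linked_def by blast
qed

text \<open>In degree 2 the fibre over the label in which all four margins are mixed is not connected:
  it has two components, told apart by this parity.\<close>
definition parity :: "bits multiset \<times> bits multiset \<Rightarrow> bool" where
  "parity u \<longleftrightarrow> mixed (fst u) \<and> mixed (snd u) \<and> ((False, False) \<in># fst u) \<noteq> ((False, False) \<in># snd u)"

definition label where
  "label u = (fst (proj (fst u)), snd (proj (fst u)), fst (proj (snd u)), snd (proj (snd u)), parity u)"

text \<open>On the \<open>False\<close> side the first factor carries the indices a, d and the
  second b, c; the margins are reordered to match the order a, c, b, d of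
  \<open>label\<close>.\<close>

definition label' where
  "label' u = (fst (proj (fst u)), snd (proj (snd u)), fst (proj (snd u)), snd (proj (fst u)), parity u)"

text \<open>From degree 3 on both factors are repetitive, so first \<open>P\<close> and then
  \<open>Q\<close> can be changed. In degree at most 1 the margins determine everything. In degree 2
  a factor that is not mixed is already determined and is repetitive, hence allows the other to
  change; two mixed factors are compared by parity.\<close>

lemma label_eq_imp_linked:
  assumes "size P = n" "size Q = n" "size P' = n" "size Q' = n" "label (P, Q) = label (P', Q')"
  shows "linked\<^sup>*\<^sup>* (P, Q) (P', Q')"
proof -
  have pr: "proj P = proj P'" "proj Q = proj Q'" and par: "parity (P, Q) = parity (P', Q')"
    using assms(5) by (auto simp: label_def prod_eq_iff)
  have mx: "mixed P' = mixed P" "mixed Q' = mixed Q" using pr by (simp_all add: mixed_def)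
  have trans: ?thesis if "repetitive Q" "repetitive P'"
    using linked_if_proj_eq(1)[OF pr(1) that(1)] linked_if_proj_eq(2)[OF pr(2) that(2)] assms by simp
  consider "n \<le> 1" | "n = 2" | "n \<ge> 3" by linarith
  thus ?thesis
  proof cases
    case 1
    have "\<not> mixed P" "\<not> mixed Q" using assms 1 by (auto simp: mixed_iff)
    then have "P = P'" "Q = Q'" using proj_eq_imp_eq pr assms 1 by auto
    then show ?thesis by simp
  next
    case 2
    show ?thesis
    proof (cases "mixed P \<and> mixed Q")
      case True
      then obtain c d where
        1: "P = {#(False, c), (True, \<not>c)#}" "Q = {#(False, d), (True, \<not>d)#}"
        unfolding mixed_iff by blast
      from True mx obtain c' d' where
        2: "P' = {#(False, c'), (True, \<not>c')#}" "Q' = {#(False, d'), (True, \<not>d')#}"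
        unfolding mixed_iff by blast
      have "parity (P, Q) \<longleftrightarrow> c \<noteq> d" "parity (P', Q') \<longleftrightarrow> c' \<noteq> d'"
        unfolding 1 2 by (simp_all add: parity_def mixed_2)
      with par have "(c' = c \<and> d' = d) \<or> (c' = (\<not>c) \<and> d' = (\<not>d))"
        by blast
      thus ?thesis
      proof
        assume "c' = c \<and> d' = d"
        thus ?thesis unfolding 1 2 by simp
      next
        assume "c' = (\<not>c) \<and> d' = (\<not>d)"
        thus ?thesis using linked_mixed[of c d] unfolding 1 2 by simp
      qed
    next
      case False
      show ?thesis
      proof (cases "mixed P")
        case True
        hence "\<not> mixed Q" using False by simp
        hence "Q = Q'" "repetitive Q" using proj_eq_imp_eq pr assms repetitive_or_mixed 2 by auto
        then show ?thesis using linked_if_proj_eq(1)[OF pr(1)] assms by simp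
      next
        case False
        hence "P = P'" "repetitive P" using proj_eq_imp_eq pr assms repetitive_or_mixed 2 by auto
        then show ?thesis using linked_if_proj_eq(2)[OF pr(2)] assms by simp
      qed
    qed
  next
    case 3
    then show ?thesis using trans repetitive_if_size_ge_3 assms by simp
  qed
qed

text \<open>Twisting permutes the four indices without changing their margins. When the two elements
  of \<open>X\<close> are complementary in all four bits, both parities say that a + b + c + d is
  odd; outside size 2 nothing is mixed.\<close>

lemma label_proj: "label (proj X) = label' (proj' X)"
proof -
  have "parity (proj X) = parity (proj' X)"
  proof (cases "size X = 2")
    case True
    then obtain x y where X: "X = {#x, y#}" using size_2_mset by blast
    obtain a b c d where x: "x = ((a, c), (b, d))" by (metis surj_pair)
    obtain a' b' c' d' where y: "y = ((a', c'), (b', d'))" by (metis surj_pair)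
    show ?thesis unfolding X x y by (auto simp: parity_def mixed_2)
  next
    case False
    have "\<not> mixed (fst (proj Y))" if "size Y = size X" for Y :: "(bits \<times> bits) multiset"
      using that False size_proj[of Y] by (auto simp: mixed_iff prod_eq_iff)
    then show ?thesis by (simp add: parity_def)
  qed
  thus ?thesis
    by (simp add: label_def label'_def) (simp add: proj_def multiset.map_comp comp_def twist_def)
qed

section \<open>Counting vertices and components\<close>

abbreviation msets :: "nat \<Rightarrow> 'a multiset set" where
  "msets n \<equiv> multisets_of_size UNIV n"

lemma msets_iff [simp]: "X \<in> msets n \<longleftrightarrow> size X = n"
  by (simp add: multisets_of_size_def)

lemma card_msets_bool: "card (msets n :: bool multiset set) = n + 1"
  by (subst card_multisets_of_size) auto

lemma card_msets_bits: "card (msets n :: bits multiset set) = (n + 3) choose 3"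
proof -
  have "card (msets n :: bits multiset set) = (card (UNIV :: bits set) + n - 1) choose n"
    by (rule card_multisets_of_size) simp
  also have "card (UNIV :: bits set) + n - 1 = n + 3" by simp
  also have "(n + 3) choose n = (n + 3) choose 3"
    using binomial_symmetric[of n "n + 3"] by simp
  finally show ?thesis .
qed

text \<open>Margins can be prescribed freely, which gives \<open>(n + 1) ^ 4\<close> labels of
  parity \<open>False\<close>. Parity \<open>True\<close> forces \<open>n = 2\<close> and all four
  margins mixed, hence adds a single label.\<close>

lemma card_labels:
  "card (label ` (msets n \<times> msets n)) = (n + 1) ^ 4 + (if n = 2 then 1 else 0)"
proof -
  let ?L = "(msets n \<times> msets n \<times> msets n \<times> msets n) :: (bool multiset \<times> bool multiset \<times> bool multiset \<times> bool multiset) set"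
  let ?FT = "{#False, True#}"
  have memb: "(A, C, B, D, False) \<in> label ` (msets n \<times> msets n)"
    if n: "size A = n" "size B = n" "size C = n" "size D = n" for A B C D
  proof -
    obtain P where P: "proj P = (A, C)" "size P = n" using proj_surj[of A C] n by auto
    obtain Q where Q: "proj Q = (B, D)" "size Q = n" using proj_surj[of B D] n by auto
    show ?thesis
    proof (cases "parity (P, Q)")
      case True
      hence "A = ?FT" "B = ?FT" "C = ?FT" "D = ?FT" "n = 2"
        using P Q n by (auto simp: parity_def mixed_def)
      thus ?thesis
        \<comment> \<open>The lift of the margins may happen to be odd; this explicit even pair has
          the same margins.\<close>
        by (intro image_eqI[of _ _ "({#(False, False), (True, True)#}, {#(False, False), (True, True)#})"])
           (auto simp: label_def parity_def)
    next
      case False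
      then show ?thesis
        using P Q by (intro image_eqI[of _ _ "(P, Q)"]) (auto simp: label_def)
    qed
  qed
  have sz: "size (fst (proj P)) = size P" "size (snd (proj P)) = size P" for P :: "bits multiset"
    by (simp_all add: proj_def)
  let ?M = "(\<lambda>(A, C, B, D). (A, C, B, D, False)) ` ?L"
  have M: "card ?M = (n + 1) ^ 4"
  proof -
    have "card ?M = card ?L" by (rule card_image) (auto simp: inj_on_def)
    also have "\<dots> = (n + 1) ^ 4" by (simp add: card_cartesian_product card_msets_bool power4_eq_xxxx)
    finally show ?thesis .
  qed
  have M_sub: "?M \<subseteq> label ` (msets n \<times> msets n)" using memb by auto
  have "label (P, Q) \<in> ?M \<or> (n = 2 \<and> label (P, Q) = (?FT, ?FT, ?FT, ?FT, True))"
    if "size P = n" "size Q = n" for P Q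
  proof (cases "parity (P, Q)")
    case True
    hence "proj P = (?FT, ?FT)" "proj Q = (?FT, ?FT)" by (auto simp: parity_def mixed_def)
    moreover from this have "n = 2" using sz[of P] that by simp
    ultimately show ?thesis using True by (simp add: label_def)
  next
    case False
    hence "label (P, Q) = (\<lambda>(A, C, B, D). (A, C, B, D, False))
        (fst (proj P), snd (proj P), fst (proj Q), snd (proj Q))" by (simp add: label_def split_beta)
    moreover have "(fst (proj P), snd (proj P), fst (proj Q), snd (proj Q)) \<in> ?L"
      using that sz by (simp add: mem_Times_iff)
    ultimately show ?thesis by blast
  qed
  hence lab: "x \<in> ?M \<or> (n = 2 \<and> x = (?FT, ?FT, ?FT, ?FT, True))"
    if "x \<in> label ` (msets n \<times> msets n)" for x
    using that by (elim imageE SigmaE) (simp only: msets_iff)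
  show ?thesis
  proof (cases "n = 2")
    case False
    have "label ` (msets n \<times> msets n) \<subseteq> ?M"
      by (rule subsetI, drule lab) (simp only: False simp_thms)
    hence "label ` (msets n \<times> msets n) = ?M" using M_sub by (rule equalityI)
    then show ?thesis using M False by simp
  next
    case True
    let ?e = "(?FT, ?FT, ?FT, ?FT, True)"
    have "?e = label ({#(False, False), (True, True)#}, {#(False, True), (True, False)#})"
      by (auto simp: label_def parity_def mixed_2 add_mset_commute)
    hence "?e \<in> label ` (msets n \<times> msets n)" using True by (intro image_eqI) auto
    hence "insert ?e ?M \<subseteq> label ` (msets n \<times> msets n)" using M_sub by (rule insert_subsetI)
    moreover have "label ` (msets n \<times> msets n) \<subseteq> insert ?e ?M"
      by (rule subsetI, drule lab) (simp only: insert_iff, metis)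
    ultimately have "label ` (msets n \<times> msets n) = insert ?e ?M" by (rule equalityI[rotated])
    moreover have "?e \<notin> ?M" by auto
    moreover have "finite ?M" by (intro finite_imageI finite_cartesian_product finite_multisets_of_size) auto
    ultimately show ?thesis using M True by simp
  qed
qed

section \<open>Independence of the vertices and the dimension count\<close>

lemma sum_fun_apply: "(\<Sum>i\<in>I. f i) x = (\<Sum>i\<in>I. f i x)"
  by (induction I rule: infinite_finite_induct) auto

lemma power_2_inj:
  assumes "(2::complex) ^ a = 2 ^ b"
  shows "a = b"
proof -
  have "norm ((2::complex) ^ a) = norm ((2::complex) ^ b)" using assms by (rule arg_cong)
  thus ?thesis by (simp add: norm_power)
qed

text \<open>On a fixed component the vertices are distinct monomials in \<open>p\<close> and
  \<open>q\<close>, that is, distinct multiplicative characters, and Dedekind's lemma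
  applies.\<close>

lemma vert_coeffs_zero:
  fixes c :: "bool \<times> bits multiset \<times> bits multiset \<Rightarrow> complex"
  assumes "finite U" and s: "(\<Sum>j\<in>UNIV \<times> U. fscale (c j) (vert (fst j) (snd j))) = 0"
    and j: "j \<in> UNIV \<times> U"
  shows "c j = 0"
proof -
  obtain s0 u0 where j0: "j = (s0, u0)" "u0 \<in> U" using j by (cases j) auto
  \<comment> \<open>The pair \<open>p\<close>, \<open>q\<close> is merged into one function on a sum
    type, so that the parameters form a monoid under pointwise multiplication.\<close>
  define ch where "ch u g = mset_monom (g \<circ> Inl) (fst u) * mset_monom (g \<circ> Inr) (snd u)"
    for u :: "bits multiset \<times> bits multiset" and g :: "bits + bits \<Rightarrow> complex"
  have "c (s0, u0) = 0"
  proof (rule Dedekind_independence[of U ch "\<lambda>u. c (s0, u)"])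
    show "finite U" "u0 \<in> U" by fact+
    show "inj_on ch U"
    proof (rule inj_onI)
      fix u v assume "ch u = ch v"
      have "count (fst u) x = count (fst v) x" for x
      proof -
        \<comment> \<open>Setting one variable to 2 and all others to 1 reads off the exponent of
          that variable.\<close>
        let ?g = "\<lambda>y :: bits + bits. case y of Inl y \<Rightarrow> if y = x then (2::complex) else 1 | Inr _ \<Rightarrow> 1"
        have "?g \<circ> Inl = (\<lambda>y. if y = x then 2 else 1)" "?g \<circ> Inr = 1" by auto
        hence "ch w ?g = 2 ^ count (fst w) x" for w
          unfolding ch_def by (simp only: mset_monom_indicator mset_monom_one mult_1_right)
        hence "(2::complex) ^ count (fst u) x = 2 ^ count (fst v) x"
          using \<open>ch u = ch v\<close> by metis
        thus ?thesis by (rule power_2_inj)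
      qed
      moreover have "count (snd u) x = count (snd v) x" for x
      proof -
        let ?g = "\<lambda>y :: bits + bits. case y of Inr y \<Rightarrow> if y = x then (2::complex) else 1 | Inl _ \<Rightarrow> 1"
        have "?g \<circ> Inr = (\<lambda>y. if y = x then 2 else 1)" "?g \<circ> Inl = 1" by auto
        hence "ch w ?g = 2 ^ count (snd w) x" for w
          unfolding ch_def by (simp only: mset_monom_indicator mset_monom_one mult_1_left)
        hence "(2::complex) ^ count (snd u) x = 2 ^ count (snd v) x"
          using \<open>ch u = ch v\<close> by metis
        thus ?thesis by (rule power_2_inj)
      qed
      ultimately show "u = v" by (simp add: prod_eq_iff multiset_eq_iff)
    qed
    show "ch u 1 = 1" for u
    proof -
      have "(1 :: bits + bits \<Rightarrow> complex) \<circ> Inl = 1" "(1 :: bits + bits \<Rightarrow> complex) \<circ> Inr = 1" by auto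
      thus ?thesis by (simp only: ch_def mset_monom_one mult_1_right)
    qed
    show "ch u (x * y) = ch u x * ch u y" for u x y
    proof -
      have "(x * y) \<circ> Inl = (x \<circ> Inl) * (y \<circ> Inl)" "(x * y) \<circ> Inr = (x \<circ> Inr) * (y \<circ> Inr)" by auto
      thus ?thesis by (simp only: ch_def mset_monom_mult mult_ac)
    qed
    show "(\<Sum>u\<in>U. c (s0, u) * ch u g) = 0" for g
    proof -
      have "0 = (\<Sum>j\<in>UNIV \<times> U. fscale (c j) (vert (fst j) (snd j))) (s0, g \<circ> Inl, g \<circ> Inr)"
        by (simp add: s)
      also have "\<dots> = (\<Sum>j\<in>UNIV \<times> U. c j * vert (fst j) (snd j) (s0, g \<circ> Inl, g \<circ> Inr))"
        by (simp add: sum_fun_apply fscale_apply)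
      also have "\<dots> = (\<Sum>s\<in>UNIV. \<Sum>u\<in>U. c (s, u) * vert s u (s0, g \<circ> Inl, g \<circ> Inr))"
        by (simp add: sum.cartesian_product split_beta)
      also have "\<dots> = (\<Sum>s\<in>UNIV. if s = s0 then (\<Sum>u\<in>U. c (s0, u) * ch u g) else 0)"
        by (intro sum.cong refl) (auto simp: vert_def ch_def)
      also have "\<dots> = (\<Sum>u\<in>U. c (s0, u) * ch u g)" by simp
      finally show ?thesis by simp
    qed
  qed
  thus ?thesis using j0 by simp
qed

text \<open>The two edges of a link share their \<open>False\<close> vertex, which cancels in their
  difference; the differences telescope along the walk.\<close>

lemma linked_vert_diff:
  assumes "linked\<^sup>*\<^sup>* u v" "size (fst u) = n"
  shows "vert True u - vert True v \<in> fun_vs.span {mset_monom ycoord X | X. size X = n}"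
proof -
  from assms(1) have "vert True u - vert True v \<in> fun_vs.span {mset_monom ycoord X | X. size X = n} \<and> size (fst v) = n"
  proof (induction rule: rtranclp_induct)
    case base
    show ?case by (simp only: diff_self fun_vs.span_zero assms(2) simp_thms)
  next
    case (step v w)
    then obtain X Y where XY: "proj X = v" "proj Y = w" "proj' X = proj' Y"
      by (auto simp: linked_def)
    have sX: "size X = n" using step.IH XY(1) by (auto simp: proj_def)
    have "size (fst (proj' X)) = size (fst (proj' Y))" by (simp only: XY)
    hence sY: "size Y = n" using sX by (simp add: proj_def)
    have "vert True v - vert True w = mset_monom ycoord X - mset_monom ycoord Y"
      by (simp only: mset_monom_ycoord XY) (simp only: add_diff_cancel_right)
    moreover have "mset_monom ycoord X - mset_monom ycoord Y \<in> fun_vs.span {mset_monom ycoord X | X. size X = n}"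
      using sX sY by (intro fun_vs.span_diff fun_vs.span_base) auto
    ultimately have "vert True v - vert True w \<in> fun_vs.span {mset_monom ycoord X | X. size X = n}" by metis
    hence "(vert True u - vert True v) + (vert True v - vert True w) \<in> fun_vs.span {mset_monom ycoord X | X. size X = n}"
      using step.IH fun_vs.span_add by blast
    moreover have "size (fst w) = n" using sY XY(2) by (auto simp: proj_def)
    ultimately show ?case by (simp only: add_diff_eq diff_add_cancel simp_thms)
  qed
  thus ?thesis by blast
qed

text \<open>Number of vertices equals dimension plus number of components, stated additively to
  avoid truncated subtraction.\<close>

lemma dim_monomials_ycoord:
  "fun_vs.dim {mset_monom ycoord X | X. size X = n} + ((n + 1) ^ 4 + (if n = 2 then 1 else 0))
     = 2 * ((n + 3) choose 3)\<^sup>2"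
proof -
  let ?U = "msets n \<times> msets n :: (bits multiset \<times> bits multiset) set"
  let ?E = "(\<lambda>X. (proj X, proj' X)) ` {X. size X = n}"
  have edges: "(\<lambda>(u, w). vert True u + vert False w) ` ?E = {mset_monom ycoord X | X. size X = n}"
    by (simp only: image_image split_conv mset_monom_ycoord[symmetric]) blast
  have fin: "finite ?U"
    by (intro finite_cartesian_product finite_multisets_of_size) auto
  have fam: "inj_on (\<lambda>j. vert (fst j) (snd j)) (UNIV \<times> ?U)"
      "fun_vs.independent ((\<lambda>j. vert (fst j) (snd j)) ` (UNIV \<times> ?U))"
    by (rule fun_vs.independent_family, rule finite_cartesian_product[OF finite fin],
        rule vert_coeffs_zero[OF fin], assumption+)+
  have im: "(\<lambda>j. vert (fst j) (snd j)) ` (UNIV \<times> ?U) = vert True ` ?U \<union> vert False ` ?U"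
    by (force simp: UNIV_bool)
  have inj: "vert s u = vert t v \<Longrightarrow> u \<in> ?U \<Longrightarrow> v \<in> ?U \<Longrightarrow> s = t \<and> u = v" for s t u v
    using inj_onD[OF fam(1), of "(s, u)" "(t, v)"] by auto
  have "fun_vs.dim ((\<lambda>(u, w). vert True u + vert False w) ` ?E) + card (label ` ?U) = card ?U + card ?U"
  proof (rule fun_vs.dim_span_edges[where lab' = label'])
    show "finite ?U" "finite ?U" by fact+
    show "inj_on (vert True) ?U" "inj_on (vert False) ?U" "vert True ` ?U \<inter> vert False ` ?U = {}"
      using inj by (fastforce simp: inj_on_def)+
    show "fun_vs.independent (vert True ` ?U \<union> vert False ` ?U)" using fam(2) im by simp
    show "?E \<subseteq> ?U \<times> ?U" by (auto simp: proj_def)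
    show "label u = label' w" if "(u, w) \<in> ?E" for u w
      using that label_proj by auto
    show "\<exists>u. (u, w) \<in> ?E" if w: "w \<in> ?U" for w
    proof -
      obtain P Q where "w = (P, Q)" "size P = n" "size Q = n" using w by auto
      then obtain X where X: "proj X = w" "size X = n" using proj_surj[of P Q] by auto
      \<comment> \<open>Since \<open>twist\<close> is an involution, twisting a lift of
        \<open>w\<close> gives an edge that ends in \<open>w\<close>.\<close>
      have "proj' (image_mset twist X) = w" using X by (simp add: multiset.map_comp comp_def)
      thus ?thesis using X by (intro exI[of _ "proj (image_mset twist X)"] image_eqI[of _ _ "image_mset twist X"]) auto
    qed
    show "vert True u - vert True v \<in> fun_vs.span ((\<lambda>(u, w). vert True u + vert False w) ` ?E)"
      if "u \<in> ?U" "v \<in> ?U" "label u = label v" for u v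
      unfolding edges
    proof (rule linked_vert_diff)
      show "size (fst u) = n" using that by auto
      show "linked\<^sup>*\<^sup>* u v" using that label_eq_imp_linked by (cases u; cases v) auto
    qed
  qed
  thus ?thesis
    unfolding edges card_labels card_cartesian_product card_msets_bits
    by (simp add: power2_eq_square)
qed

section \<open>Parametrisation of the cone\<close>

lemma sum_bits: "sum f (UNIV :: bits set) = f (False, False) + f (False, True) + f (True, False) + f (True, True)"
  by (simp add: UNIV_Times_UNIV [symmetric] UNIV_bool sum.cartesian_product' [symmetric] add_ac
       del: UNIV_Times_UNIV)

lemma forall_bits: "(\<forall>x :: bits. P x) \<longleftrightarrow> P (False, False) \<and> P (False, True) \<and> P (True, False) \<and> P (True, True)"
  by (auto simp: all_bool_eq)

text \<open>\<open>C_mat\<close> sends \<open>v\<close> to the entries of the matrix with rows \<open>(v\<^sub>1 + \<i> v\<^sub>2, v\<^sub>3 + \<i> v\<^sub>4)\<close> and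
  \<open>(- v\<^sub>3 + \<i> v\<^sub>4, v\<^sub>1 - \<i> v\<^sub>2)\<close>, whose determinant is the sum of squares of \<open>v\<close>; \<open>D_mat\<close> is its inverse.\<close>
definition C_mat :: "complex^4^bits" where
  "C_mat = (\<chi> s i. if fst s = snd s
     then (if i = 1 then 1 else if i = 2 then (if fst s then -\<i> else \<i>) else 0)
     else (if i = 3 then (if fst s then -1 else 1) else if i = 4 then \<i> else 0))"

definition D_mat :: "complex^bits^4" where
  "D_mat = (\<chi> i s. cnj (C_mat $ s $ i) / 2)"

text \<open>In the basis of matrix units, with rows (a, b) and columns (c, d), this is the matrix of
  \<open>X\<close> mapped to p X q^T or, on the \<open>False\<close> component, to p X^T
  q^T.\<close>

definition tensor :: "param \<Rightarrow> complex^bits^bits" where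
  "tensor z = (\<chi> s t. ycoord ((fst s, fst t), (snd s, snd t)) z)"

definition par :: "param \<Rightarrow> cmat4" where
  "par z = D_mat ** tensor z ** C_mat"

lemma C_D: "C_mat ** D_mat = mat 1"
  unfolding vec_eq_iff forall_bits
  by (simp add: matrix_matrix_mult_def mat_def D_mat_def C_mat_def sum_4)

lemma D_C: "D_mat ** C_mat = mat 1"
  unfolding vec_eq_iff forall_4
  by (simp add: matrix_matrix_mult_def mat_def D_mat_def C_mat_def sum_bits)

lemma par_component: "par z $ i $ j = (\<Sum>t\<in>UNIV. \<Sum>s\<in>UNIV. D_mat $ i $ s * C_mat $ t $ j * ycoord ((fst s, fst t), (snd s, snd t)) z)"
  by (simp add: par_def matrix_matrix_mult_def tensor_def sum_distrib_right sum_distrib_left mult_ac)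

lemma tensor_par: "C_mat ** par z ** D_mat = tensor z"
proof -
  have "C_mat ** par z ** D_mat = (C_mat ** D_mat) ** tensor z ** (C_mat ** D_mat)"
    by (simp only: par_def matrix_mul_assoc)
  thus ?thesis by (simp only: C_D matrix_mul_lid matrix_mul_rid)
qed

lemma ycoord_par: "ycoord ((a, c), (b, d)) z = (\<Sum>j\<in>UNIV. \<Sum>i\<in>UNIV. C_mat $ (a, b) $ i * D_mat $ j $ (c, d) * par z $ i $ j)"
proof -
  have "ycoord ((a, c), (b, d)) z = tensor z $ (a, b) $ (c, d)" by (simp add: tensor_def)
  also have "\<dots> = (C_mat ** par z ** D_mat) $ (a, b) $ (c, d)" by (simp only: tensor_par)
  also have "\<dots> = (\<Sum>j\<in>UNIV. \<Sum>i\<in>UNIV. C_mat $ (a, b) $ i * D_mat $ j $ (c, d) * par z $ i $ j)"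
    by (simp add: matrix_matrix_mult_def sum_distrib_right sum_distrib_left mult_ac)
  finally show ?thesis .
qed

section \<open>Composition and the determinant form\<close>

definition mult2 :: "(bits \<Rightarrow> complex) \<Rightarrow> (bits \<Rightarrow> complex) \<Rightarrow> bits \<Rightarrow> complex" where
  "mult2 p q s = p (fst s, False) * q (False, snd s) + p (fst s, True) * q (True, snd s)"

definition one2 :: "bits \<Rightarrow> complex" where
  "one2 s = (if fst s = snd s then 1 else 0)"

definition det2 :: "(bits \<Rightarrow> complex) \<Rightarrow> complex" where
  "det2 p = p (False, False) * p (True, True) - p (False, True) * p (True, False)"

text \<open>A left factor on the \<open>False\<close> component transposes the inner map: p (p' X
  q'^T)^T q^T = (p q') X^T (q p')^T, and similarly for an inner transpose. This explains the crossed
  products.\<close>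

lemma tensor_mult:
  "tensor (False, p, q) ** tensor (s, p', q') = tensor (\<not> s, mult2 p q', mult2 q p')"
  unfolding vec_eq_iff
  by (cases s) (auto simp: matrix_matrix_mult_def tensor_def ycoord_def mult2_def sum_bits algebra_simps)

lemma par_mult: "par (False, p, q) ** par (s, p', q') = par (\<not> s, mult2 p q', mult2 q p')"
proof -
  have "par (False, p, q) ** par (s, p', q')
      = D_mat ** tensor (False, p, q) ** (C_mat ** D_mat) ** tensor (s, p', q') ** C_mat"
    by (simp only: par_def matrix_mul_assoc)
  also have "\<dots> = D_mat ** (tensor (False, p, q) ** tensor (s, p', q')) ** C_mat"
    by (simp only: C_D matrix_mul_rid matrix_mul_assoc)
  finally show ?thesis by (simp only: tensor_mult par_def)
qed

lemma par_one: "par (True, one2, one2) = mat 1"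
proof -
  have "tensor (True, one2, one2) = mat 1"
    unfolding vec_eq_iff by (auto simp: tensor_def ycoord_def one2_def mat_def prod_eq_iff)
  thus ?thesis by (simp only: par_def matrix_mul_rid D_C)
qed

text \<open>The middle matrix is the Gram matrix of the determinant form on 2 by 2 matrices, and det
  (p X q^T) = det p det q det X, also with X transposed.\<close>

lemma tensor_form:
  "transpose (tensor (s, p, q)) ** (transpose D_mat ** D_mat) ** tensor (s, p, q)
     = (\<chi> i j. det2 p * det2 q * (transpose D_mat ** D_mat) $ i $ j)"
proof -
  have J: "transpose D_mat ** D_mat = (\<chi> s t. if t = (\<not> fst s, \<not> snd s) then (if fst s = snd s then 1/2 else -1/2) else 0)"
    unfolding vec_eq_iff forall_bits
    by (simp add: matrix_matrix_mult_def transpose_def D_mat_def C_mat_def sum_4)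
  show ?thesis
    unfolding J vec_eq_iff forall_bits
    by (cases s) (simp_all add: matrix_matrix_mult_def transpose_def tensor_def ycoord_def sum_bits det2_def algebra_simps)
qed

lemma par_orthogonal:
  "transpose (par (s, p, q)) ** par (s, p, q) = (\<chi> i j. det2 p * det2 q * mat 1 $ i $ j)"
proof -
  let ?T = "tensor (s, p, q)" and ?J = "transpose D_mat ** D_mat"
  have lin: "A ** (\<chi> i j. c * X $ i $ j) ** B = (\<chi> i j. c * (A ** X ** B) $ i $ j)"
    for A :: "complex^bits^4" and X :: "complex^bits^bits" and B :: "complex^4^bits" and c
    by (simp add: vec_eq_iff matrix_matrix_mult_def sum_distrib_left sum_distrib_right mult_ac)
  have "transpose (par (s, p, q)) ** par (s, p, q) = transpose C_mat ** (transpose ?T ** ?J ** ?T) ** C_mat"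
    by (simp only: par_def matrix_transpose_mul matrix_mul_assoc)
  also have "\<dots> = (\<chi> i j. det2 p * det2 q * (transpose C_mat ** ?J ** C_mat) $ i $ j)"
    by (simp only: tensor_form lin)
  also have "transpose C_mat ** ?J ** C_mat = transpose (D_mat ** C_mat) ** (D_mat ** C_mat)"
    by (simp only: matrix_transpose_mul matrix_mul_assoc)
  finally show ?thesis by (simp only: D_C transpose_mat matrix_mul_lid)
qed

lemma par_in_cone:
  assumes "det2 p \<noteq> 0" "det2 q \<noteq> 0"
  shows "par (s, p, q) \<in> cone_set"
proof -
  \<comment> \<open>Dividing by a square root of the similitude factor produces an orthogonal
    matrix.\<close>
  define c where "c = csqrt (det2 p * det2 q)"
  have c: "c * c = det2 p * det2 q" "c \<noteq> 0"
    using assms by (auto simp: c_def power2_eq_square[symmetric])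
  define M :: cmat4 where "M = (\<chi> i j. par (s, p, q) $ i $ j / c)"
  have "(transpose M ** M) $ i $ j = mat 1 $ i $ j" for i j
  proof -
    have "(transpose M ** M) $ i $ j = (transpose (par (s, p, q)) ** par (s, p, q)) $ i $ j / (c * c)"
      by (simp add: M_def matrix_matrix_mult_def transpose_def sum_divide_distrib)
    also have "\<dots> = mat 1 $ i $ j" using c assms by (simp add: par_orthogonal)
    finally show ?thesis .
  qed
  hence "M \<in> O4" by (simp add: O4_def vec_eq_iff)
  moreover have "par (s, p, q) = (\<chi> i j. c * M $ i $ j)"
    using c by (simp add: M_def vec_eq_iff)
  ultimately show ?thesis unfolding cone_set_def by blast
qed

lemma range_par_scale:
  assumes "M \<in> range par"
  shows "(\<chi> i j. c * M $ i $ j) \<in> range par"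
proof -
  obtain s p q where M: "M = par (s, p, q)" using assms by auto
  have "(\<chi> i j. c * M $ i $ j) = par (s, (\<lambda>x. c * p x), q)"
    unfolding M vec_eq_iff
    by (simp add: par_component ycoord_def Let_def sum_distrib_left mult_ac)
  thus ?thesis by blast
qed

section \<open>Reflections and the orthogonal group\<close>

definition sqsum :: "complex^4 \<Rightarrow> complex" where
  "sqsum v = (\<Sum>i\<in>UNIV. v $ i * v $ i)"

text \<open>The form is bilinear, not Hermitian, so nonzero isotropic vectors exist; only for
  \<open>sqsum v\<close> different from 0 is this a genuine reflection.\<close>

definition reflection :: "complex^4 \<Rightarrow> cmat4" where
  "reflection v = (\<chi> i j. (if i = j then 1 else 0) - 2 * v $ i * v $ j / sqsum v)"

lemma transpose_refl: "transpose (reflection v) = reflection v"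
  by (simp add: reflection_def transpose_def vec_eq_iff)

lemma refl_mult_component:
  "(reflection v ** M) $ i $ j = M $ i $ j - 2 * v $ i * (\<Sum>k\<in>UNIV. v $ k * M $ k $ j) / sqsum v"
proof -
  have "(reflection v ** M) $ i $ j = (\<Sum>k\<in>UNIV. (if i = k then M $ k $ j else 0) - 2 * v $ i / sqsum v * (v $ k * M $ k $ j))"
    by (auto simp: reflection_def matrix_matrix_mult_def algebra_simps intro!: sum.cong)
  also have "\<dots> = M $ i $ j - 2 * v $ i / sqsum v * (\<Sum>k\<in>UNIV. v $ k * M $ k $ j)"
    by (simp add: sum_subtractf sum_distrib_left)
  finally show ?thesis by simp
qed

lemma refl_refl:
  assumes "sqsum v \<noteq> 0"
  shows "reflection v ** reflection v = mat 1"
proof -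
  have *: "(\<Sum>k\<in>UNIV. v $ k * reflection v $ k $ j) = - v $ j" for j
  proof -
    have "(\<Sum>k\<in>UNIV. v $ k * reflection v $ k $ j) = (\<Sum>k\<in>UNIV. (if k = j then v $ k else 0) - 2 * v $ j / sqsum v * (v $ k * v $ k))"
      by (auto simp: reflection_def algebra_simps intro!: sum.cong)
    also have "\<dots> = v $ j - 2 * v $ j / sqsum v * sqsum v"
      by (simp add: sum_subtractf sum_distrib_left sqsum_def)
    finally show ?thesis using assms by simp
  qed
  show ?thesis
    unfolding vec_eq_iff by (simp add: refl_mult_component * mat_def) (simp add: reflection_def)
qed

text \<open>For \<open>V = C_mat v\<close> the reflection in \<open>v\<close> is \<open>X \<mapsto> - V adj(X) V / det V\<close> on 2 by 2 matrices.\<close>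
lemma refl_eq_par:
  assumes "sqsum v \<noteq> 0"
  defines "V \<equiv> \<lambda>s. \<Sum>i\<in>UNIV. C_mat $ s $ i * v $ i"
  shows "reflection v = par (False, (\<lambda>s. (if snd s then - V (fst s, False) else V (fst s, True)) / sqsum v),
                              (\<lambda>s. (if snd s then V (False, fst s) else - V (True, fst s))))"
proof -
  have eq: "reflection v $ i $ j * sqsum v = (if i = j then sqsum v else 0) - 2 * v $ i * v $ j" for i j
    using assms(1) by (simp add: reflection_def field_simps)
  have "reflection v $ i $ j * sqsum v = par (False, (\<lambda>s. (if snd s then - V (fst s, False) else V (fst s, True)) / sqsum v),
                              (\<lambda>s. (if snd s then V (False, fst s) else - V (True, fst s)))) $ i $ j * sqsum v" for i j
  proof -
    have 1: "par (False, (\<lambda>s. (if snd s then - V (fst s, False) else V (fst s, True)) / sqsum v),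
                              (\<lambda>s. (if snd s then V (False, fst s) else - V (True, fst s)))) $ i $ j * sqsum v
      = par (False, (\<lambda>s. (if snd s then - V (fst s, False) else V (fst s, True))),
                              (\<lambda>s. (if snd s then V (False, fst s) else - V (True, fst s)))) $ i $ j"
      using assms(1) by (simp add: par_component ycoord_def Let_def sum_distrib_right twist_def)
    have "\<forall>i j. (if i = j then sqsum v else 0) - 2 * v $ i * v $ j = par (False, (\<lambda>s. (if snd s then - V (fst s, False) else V (fst s, True))),
                              (\<lambda>s. (if snd s then V (False, fst s) else - V (True, fst s)))) $ i $ j"
      unfolding forall_4 par_component
      by (simp add: ycoord_def twist_def sum_bits sum_4 V_def D_mat_def C_mat_def sqsum_def field_simps)
    thus ?thesis using 1 eq by simp
  qed
  thus ?thesis using assms(1) by (simp add: vec_eq_iff)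
qed

lemma refl_mult_range_par:
  assumes "sqsum v \<noteq> 0" "M \<in> range par"
  shows "reflection v ** M \<in> range par"
proof -
  obtain s p q where M: "M = par (s, p, q)" using assms(2) by auto
  show ?thesis unfolding M refl_eq_par[OF assms(1)] par_mult by blast
qed

lemma range_par_reflD:
  assumes "sqsum v \<noteq> 0" "reflection v ** M \<in> range par"
  shows "M \<in> range par"
  using refl_mult_range_par[OF assms] refl_refl[OF assms(1)]
  by (simp only: matrix_mul_assoc matrix_mul_lid)

lemma refl_O4:
  assumes "sqsum v \<noteq> 0" "M \<in> O4"
  shows "reflection v ** M \<in> O4"
proof -
  have "transpose (reflection v ** M) ** (reflection v ** M) = transpose M ** (reflection v ** reflection v) ** M"
    by (simp only: matrix_transpose_mul transpose_refl matrix_mul_assoc)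
  thus ?thesis using assms by (simp add: refl_refl O4_def)
qed

lemma O4_columns:
  assumes "M \<in> O4"
  shows "(\<Sum>k\<in>UNIV. M $ k $ i * M $ k $ j) = (if i = j then 1 else 0)"
proof -
  have "(transpose M ** M) $ i $ j = mat 1 $ i $ j" using assms by (simp add: O4_def)
  thus ?thesis by (simp add: matrix_matrix_mult_def transpose_def mat_def)
qed

text \<open>Cartan--Dieudonne: reflections turn the columns of \<open>M\<close> into standard basis vectors one by one.\<close>
lemma O4_fixing_in_range_par:
  assumes "finite K" "M \<in> O4" "\<And>i j. j \<notin> K \<Longrightarrow> M $ i $ j = (if i = j then 1 else 0)"
  shows "M \<in> range par"
  using assms
proof (induction K arbitrary: M rule: finite_induct)
  case empty
  hence "M = mat 1" by (simp add: vec_eq_iff mat_def)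
  then show ?case using par_one by (metis rangeI)
next
  case (insert k K)
  have step: "N \<in> range par" if N: "N \<in> O4" "\<And>i j. j \<notin> insert k K \<Longrightarrow> N $ i $ j = (if i = j then 1 else 0)"
    and ne: "N $ k $ k \<noteq> 1" for N
  proof -
    \<comment> \<open>Reflection in the difference between column \<open>k\<close> and the basis
      vector interchanges the two.\<close>
    define w where "w = (\<chi> i. N $ i $ k - (if i = k then 1 else 0))"
    have wN: "(\<Sum>i\<in>UNIV. w $ i * N $ i $ j) = (if j = k then 1 else 0) - N $ k $ j" for j
    proof -
      have "(\<Sum>i\<in>UNIV. w $ i * N $ i $ j) = (\<Sum>i\<in>UNIV. N $ i $ k * N $ i $ j - (if i = k then N $ i $ j else 0))"
        by (auto simp: w_def algebra_simps intro!: sum.cong)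
      thus ?thesis by (simp add: sum_subtractf O4_columns[OF N(1)] eq_commute)
    qed
    have ww: "sqsum w = 2 * (1 - N $ k $ k)"
    proof -
      have "sqsum w = (\<Sum>i\<in>UNIV. w $ i * N $ i $ k - (if i = k then w $ i else 0))"
        by (auto simp: sqsum_def w_def algebra_simps intro!: sum.cong)
      also have "\<dots> = 2 * (1 - N $ k $ k)" by (simp add: sum_subtractf wN) (simp add: w_def)
      finally show ?thesis .
    qed
    hence w0: "sqsum w \<noteq> 0" using ne by simp
    have "reflection w ** N \<in> range par"
    proof (rule insert.IH)
      show "reflection w ** N \<in> O4" by (rule refl_O4[OF w0 N(1)])
      fix i j assume j: "j \<notin> K"
      show "(reflection w ** N) $ i $ j = (if i = j then 1 else 0)"
      proof (cases "j = k")
        case True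
        have "(reflection w ** N) $ i $ k = N $ i $ k - w $ i"
          using ne by (simp add: refl_mult_component wN ww del: right_diff_distrib_numeral)
        then show ?thesis using True by (simp add: w_def)
      next
        case False
        \<comment> \<open>Hence column \<open>j\<close> is orthogonal to \<open>w\<close> and stays
          fixed.\<close>
        hence "N $ k $ j = 0" using N(2)[of j k] j by auto
        then show ?thesis using False N(2)[of j i] j by (simp add: refl_mult_component wN)
      qed
    qed
    thus ?thesis by (rule range_par_reflD[OF w0])
  qed
  show ?case
  proof (cases "M $ k $ k = 1")
    case False
    then show ?thesis using step insert.prems by blast
  next
    case True
    \<comment> \<open>Here the difference vector would be isotropic. Reflecting first in the basis
      vector turns the diagonal entry into -1, after which \<open>step\<close> applies.\<close>
    define e :: "complex^4" where "e = (\<chi> i. if i = k then 1 else 0)"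
    have e1: "sqsum e = 1" by (simp add: sqsum_def e_def if_distrib cong: if_cong)
    have c: "(reflection e ** M) $ i $ j = M $ i $ j - 2 * (if i = k then M $ k $ j else 0)" for i j
      by (simp add: refl_mult_component e1) (simp add: e_def mult_delta_left)
    have "reflection e ** M \<in> range par"
    proof (rule step)
      show "reflection e ** M \<in> O4" using refl_O4 e1 insert.prems(1) by simp
      show "(reflection e ** M) $ i $ j = (if i = j then 1 else 0)" if "j \<notin> insert k K" for i j
        using insert.prems(2)[OF that] that by (auto simp: c)
      show "(reflection e ** M) $ k $ k \<noteq> 1" using True by (simp add: c)
    qed
    thus ?thesis by (rule range_par_reflD[rotated]) (simp add: e1)
  qed
qed

lemma cone_subset_range_par: "cone_set \<subseteq> range par"
proof
  fix x assume "x \<in> cone_set"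
  then obtain c M where x: "x = (\<chi> i j. c * M $ i $ j)" "M \<in> O4" by (auto simp: cone_set_def)
  have "M \<in> range par" by (rule O4_fixing_in_range_par[of UNIV]) (use x in auto)
  thus "x \<in> range par" using range_par_scale x by simp
qed

section \<open>Hilbert function and Hilbert series\<close>

definition entry :: "4 \<times> 4 \<Rightarrow> cmat4 \<Rightarrow> complex" where
  "entry x M = M $ fst x $ snd x"

lemma monomial_fn_count: "monomial_fn (\<lambda>i j. count X (i, j)) = mset_monom entry X"
proof
  fix M
  have "mset_monom entry X M = (\<Prod>x\<in>set_mset X. entry x M ^ count X x)"
    unfolding mset_monom_apply by (simp add: mset_monom_def image_prod_mset_multiplicity)
  also have "\<dots> = (\<Prod>x\<in>UNIV. entry x M ^ count X x)"
    by (rule prod.mono_neutral_left) (auto simp: not_in_iff)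
  also have "\<dots> = monomial_fn (\<lambda>i j. count X (i, j)) M"
    by (simp add: monomial_fn_def entry_def prod.cartesian_product split_beta flip: UNIV_Times_UNIV)
  finally show "monomial_fn (\<lambda>i j. count X (i, j)) M = mset_monom entry X M" ..
qed

lemma mono_deg_count: "mono_deg (\<lambda>i j. count X (i, j)) = size X"
proof -
  have "size X = (\<Sum>x\<in>UNIV. count X x)"
    unfolding size_multiset_overloaded_eq by (rule sum.mono_neutral_left) (auto simp: not_in_iff)
  also have "\<dots> = mono_deg (\<lambda>i j. count X (i, j))"
    by (simp add: mono_deg_def sum.cartesian_product split_beta flip: UNIV_Times_UNIV)
  finally show ?thesis ..
qed

lemma hom_poly_fns_eq: "hom_poly_fns d = fun_vs.span {mset_monom entry X | X. size X = d}"
proof -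
  have count_ex: "\<exists>X. a = (\<lambda>i j. count X (i, j))" for a :: "4 \<Rightarrow> 4 \<Rightarrow> nat"
    by (rule exI[of _ "Abs_multiset (\<lambda>x. a (fst x) (snd x))"]) (simp add: Abs_multiset_inverse)
  have "{monomial_fn a | a. mono_deg a = d} = {mset_monom entry X | X. size X = d}"
  proof (intro equalityI subsetI)
    fix f assume "f \<in> {monomial_fn a | a. mono_deg a = d}"
    then obtain a where a: "f = monomial_fn a" "mono_deg a = d" by blast
    obtain X where X: "a = (\<lambda>i j. count X (i, j))" using count_ex by blast
    show "f \<in> {mset_monom entry X | X. size X = d}"
      using a unfolding X monomial_fn_count mono_deg_count by blast
  next
    fix f assume "f \<in> {mset_monom entry X | X. size X = d}"
    then obtain X where "f = mset_monom entry X" "size X = d" by blast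
    thus "f \<in> {monomial_fn a | a. mono_deg a = d}"
      unfolding monomial_fn_count[symmetric] mono_deg_count[symmetric] by blast
  qed
  thus ?thesis by (simp add: hom_poly_fns_def)
qed

lemma hom_poly_fns_subset: "hom_poly_fns d \<subseteq> poly_fns"
  unfolding hom_poly_fns_def poly_fns_def by (rule fun_vs.span_mono) auto

section \<open>Vanishing on the cone\<close>

lemma continuous_on_poly_fns:
  assumes "f \<in> poly_fns"
  shows "continuous_on UNIV f"
  using assms unfolding poly_fns_def
proof (induction rule: fun_vs.span_induct_alt)
  case base
  show ?case by (simp add: zero_fun_def)
next
  case (step c x y)
  then obtain a where "x = monomial_fn a" by auto
  hence "continuous_on UNIV x" by (auto simp: monomial_fn_def[abs_def] intro!: continuous_intros)
  then show ?case using step(2) by (simp add: fscale_def plus_fun_def) (intro continuous_intros)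
qed

text \<open>Shifting \<open>p\<close> and \<open>q\<close> by small multiples of the identity makes both invertible.\<close>
lemma poly_fn_vanishes_on_range_par:
  assumes "f \<in> poly_fns" and van: "\<And>y. y \<in> cone_set \<Longrightarrow> f y = 0"
  shows "f (par z) = 0"
proof -
  obtain s p q where z: "z = (s, p, q)" by (cases z)
  define g where "g r t x = r x + t * one2 x" for r t x
  define F where "F t = f (par (s, g p t, g q t))" for t
  have "continuous_on UNIV (\<lambda>t. par (s, g p t, g q t) $ i $ j)" for i j
    by (cases s) (auto simp: par_component ycoord_def g_def intro!: continuous_intros)
  hence "continuous_on UNIV (\<lambda>t. \<chi> i j. par (s, g p t, g q t) $ i $ j)"
    by (intro continuous_on_vec_lambda)
  hence "continuous_on UNIV (\<lambda>t. par (s, g p t, g q t))" by simp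
  hence "continuous_on UNIV F"
    unfolding F_def using continuous_on_compose2[OF continuous_on_poly_fns[OF assms(1)]] by blast
  hence "F \<midarrow>0\<rightarrow> F 0" by (simp add: continuous_on_eq_continuous_within isCont_def)
  moreover have "eventually (\<lambda>t. F t = 0) (at 0)"
  proof -
    \<comment> \<open>The shifted determinant is a monic quadratic in \<open>t\<close>, so it
      vanishes for finitely many \<open>t\<close> only.\<close>
    have d: "det2 (g r t) = poly [:det2 r, r (False, False) + r (True, True), 1:] t" for r t
      by (simp add: det2_def g_def one2_def algebra_simps)
    have "finite {t. det2 (g r t) = 0}" for r
      unfolding d by (rule poly_roots_finite) simp
    hence "eventually (\<lambda>t. det2 (g r t) \<noteq> 0) (at 0)" for r
      using islimpt_finite[of "{t. det2 (g r t) = 0}" 0] by (simp add: islimpt_iff_eventually)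
    hence "eventually (\<lambda>t. det2 (g p t) \<noteq> 0 \<and> det2 (g q t) \<noteq> 0) (at 0)"
      by (intro eventually_conj) auto
    thus ?thesis
      by (rule eventually_mono) (auto simp: F_def intro!: van par_in_cone)
  qed
  hence "F \<midarrow>0\<rightarrow> 0" by (rule tendsto_eventually)
  ultimately have "F 0 = 0" by (rule tendsto_unique[OF at_neq_bot])
  moreover have "g r 0 = r" for r by (simp add: g_def fun_eq_iff)
  ultimately show ?thesis by (simp add: F_def z)
qed

text \<open>The range of \<open>par\<close> contains \<open>cone_set\<close> and lies in its Zariski
  closure, so a polynomial vanishes on all three sets or on none.\<close>

lemma vanish_iff:
  assumes "f \<in> poly_fns"
  shows "(\<forall>x\<in>cone_O4. f x = 0) \<longleftrightarrow> (\<forall>z. f (par z) = 0)"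
proof
  assume a: "\<forall>x\<in>cone_O4. f x = 0"
  have "cone_set \<subseteq> cone_O4" by (auto simp: cone_O4_def zariski_closure_def)
  thus "\<forall>z. f (par z) = 0" using poly_fn_vanishes_on_range_par[OF assms] a by blast
next
  assume "\<forall>z. f (par z) = 0"
  hence "\<forall>y\<in>cone_set. f y = 0" using cone_subset_range_par by fastforce
  thus "\<forall>x\<in>cone_O4. f x = 0" using assms by (auto simp: cone_O4_def zariski_closure_def)
qed

section \<open>Graded pieces as spaces of functions of the parameters\<close>

interpretation fun_pair: vector_space_pair
  "fscale :: complex \<Rightarrow> ('a \<Rightarrow> complex) \<Rightarrow> 'a \<Rightarrow> complex"
  "fscale :: complex \<Rightarrow> ('b \<Rightarrow> complex) \<Rightarrow> 'b \<Rightarrow> complex"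
  by unfold_locales

lemma linear_pullback: "Vector_Spaces.linear fscale fscale (\<lambda>f. f \<circ> g)"
  by unfold_locales (auto simp: fscale_def)

lemma linear_restriction: "Vector_Spaces.linear fscale fscale (\<lambda>f x. if x \<in> V then f x else 0)"
  by unfold_locales (auto simp: fscale_def)

lemma span_scaled_sums:
  assumes "\<And>i j. f i j \<in> fun_vs.span A"
  shows "(\<lambda>z. \<Sum>i\<in>I. \<Sum>j\<in>J. c i j * f i j z) \<in> fun_vs.span A"
proof -
  have "(\<lambda>z. \<Sum>i\<in>I. \<Sum>j\<in>J. c i j * f i j z) = (\<Sum>i\<in>I. \<Sum>j\<in>J. fscale (c i j) (f i j))"
    by (simp add: fun_eq_iff sum_fun_apply fscale_apply)
  also have "\<dots> \<in> fun_vs.span A"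
    by (intro fun_vs.span_sum fun_vs.span_scale assms)
  finally show ?thesis .
qed

text \<open>The entries of \<open>par z\<close> and the coordinates \<open>ycoord\<close> are linear
  combinations of each other, by conjugation with \<open>C_mat\<close>, so their monomials of degree
  \<open>d\<close> span the same space.\<close>

lemma pullback_hom_poly_fns:
  "(\<lambda>f. f \<circ> par) ` hom_poly_fns d = fun_vs.span {mset_monom ycoord X | X. size X = d}"
proof -
  define h where "h x z = entry x (par z)" for x z
  have hy: "h x \<in> fun_vs.span (range ycoord)" for x
    unfolding h_def[abs_def] entry_def par_component
    by (rule span_scaled_sums) (auto intro: fun_vs.span_base)
  have yh: "ycoord x \<in> fun_vs.span (range h)" for x
  proof -
    obtain a b c d where x: "x = ((a, c), (b, d))" by (metis surj_pair)
    have "ycoord x = (\<lambda>z. \<Sum>j\<in>UNIV. \<Sum>i\<in>UNIV. C_mat $ (a, b) $ i * D_mat $ j $ (c, d) * h (i, j) z)"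
      by (simp add: fun_eq_iff x ycoord_par h_def entry_def)
    also have "\<dots> \<in> fun_vs.span (range h)"
      by (rule span_scaled_sums) (auto intro: fun_vs.span_base)
    finally show ?thesis .
  qed
  have pb: "mset_monom entry X \<circ> par = mset_monom h X" for X
    by (simp add: fun_eq_iff mset_monom_apply h_def)
  have "(\<lambda>f. f \<circ> par) ` hom_poly_fns d = fun_vs.span ((\<lambda>f. f \<circ> par) ` {mset_monom entry X | X. size X = d})"
    unfolding hom_poly_fns_eq by (rule fun_pair.linear_span_image[OF linear_pullback, symmetric])
  also have "(\<lambda>f. f \<circ> par) ` {mset_monom entry X | X. size X = d} = {mset_monom h X | X. size X = d}"
    unfolding pb[symmetric] by blast
  also have "fun_vs.span {mset_monom h X | X. size X = d} = fun_vs.span {mset_monom ycoord X | X. size X = d}"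
  proof (intro equalityI fun_vs.span_minimal fun_vs.subspace_span subsetI)
    fix f assume "f \<in> {mset_monom h X | X. size X = d}"
    thus "f \<in> fun_vs.span {mset_monom ycoord X | X. size X = d}"
      using mset_monom_in_span[of h, OF hy] by blast
  next
    fix f assume "f \<in> {mset_monom ycoord X | X. size X = d}"
    thus "f \<in> fun_vs.span {mset_monom h X | X. size X = d}"
      using mset_monom_in_span[of ycoord, OF yh] by blast
  qed
  finally show ?thesis .
qed

lemma hilb_coeff_cone_eq_dim:
  "hilb_coeff cone_O4 d = fun_vs.dim {mset_monom ycoord X | X. size X = d}"
proof -
  let ?res = "\<lambda>f x. if x \<in> cone_O4 then f x else (0 :: complex)"
  have "coord_ring_deg cone_O4 d = ?res ` hom_poly_fns d"
    by (auto simp: coord_ring_deg_def)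
  hence "hilb_coeff cone_O4 d = fun_vs.dim (?res ` hom_poly_fns d)"
    by (simp add: hilb_coeff_def)
  also have "\<dots> = fun_vs.dim ((\<lambda>f. f \<circ> par) ` hom_poly_fns d)"
  proof (rule fun_pair.dim_image_eq_of_kernel_eq)
    show "fun_vs.subspace (hom_poly_fns d)"
      unfolding hom_poly_fns_def by (rule fun_vs.subspace_span)
    show "vector_space (fscale :: complex \<Rightarrow> (param \<Rightarrow> complex) \<Rightarrow> _)" by unfold_locales
    fix f assume f: "f \<in> hom_poly_fns d"
    show "?res f = 0 \<longleftrightarrow> f \<circ> par = 0"
      using vanish_iff[OF subsetD[OF hom_poly_fns_subset f]] by (auto simp: fun_eq_iff)
  qed (rule linear_restriction linear_pullback)+
  also have "\<dots> = fun_vs.dim {mset_monom ycoord X | X. size X = d}"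
    by (simp add: pullback_hom_poly_fns)
  finally show ?thesis .
qed

section \<open>Closed form and generating function\<close>

lemma hilb_coeff_cone:
  "real (hilb_coeff cone_O4 d) =
     (if d = 2 then 118
      else 1/18 * real d^6 + 2/3 * real d^5 + 20/9 * real d^4 + 4 * real d^3
           + 85/18 * real d^2 + 10/3 * real d + 1)"
proof -
  have bin: "real ((d + 3) choose 3) = (real d + 1) * (real d + 2) * (real d + 3) / 6"
    unfolding binomial_gbinomial gbinomial_prod_rev
    by (simp add: numeral_3_eq_3 algebra_simps)
  have "real (hilb_coeff cone_O4 d) + ((real d + 1) ^ 4 + (if d = 2 then 1 else 0))
      = 2 * (real ((d + 3) choose 3))\<^sup>2"
    using arg_cong[OF dim_monomials_ycoord[of d], of real] unfolding hilb_coeff_cone_eq_dim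
    by (simp add: add_ac split: if_splits)
  hence "real (hilb_coeff cone_O4 d) = 2 * ((real d + 1) * (real d + 2) * (real d + 3) / 6)\<^sup>2
      - (real d + 1) ^ 4 - (if d = 2 then 1 else 0)"
    unfolding bin by linarith
  also have "2 * ((real d + 1) * (real d + 2) * (real d + 3) / 6)\<^sup>2 - (real d + 1) ^ 4
      = 1/18 * real d^6 + 2/3 * real d^5 + 20/9 * real d^4 + 4 * real d^3
           + 85/18 * real d^2 + 10/3 * real d + 1"
    by (simp add: field_simps power_numeral_reduce)
  finally show ?thesis by simp
qed

text \<open>Multiplication by the seventh power of \<open>1 - fps_X\<close> takes seventh
  differences, which annihilate polynomials of degree 6; finitely many coefficients remain to be
  compared.\<close>

lemma hilbert_series_eq:
  fixes h :: "nat \<Rightarrow> real"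
  assumes h: "\<And>d. h d = (if d = 2 then 118
      else 1/18 * real d^6 + 2/3 * real d^5 + 20/9 * real d^4 + 4 * real d^3
           + 85/18 * real d^2 + 10/3 * real d + 1)"
  shows "Abs_fps h =
           (1 + 9 * fps_X + 27 * fps_X^2 + 19 * fps_X^3 - 30 * fps_X^4 + 34 * fps_X^5
              - 35 * fps_X^6 + 21 * fps_X^7 - 7 * fps_X^8 + fps_X^9) / (1 - fps_X) ^ 7" (is "?H = ?N / _")
proof -
  have e: "(1 - fps_X :: real fps) ^ 7 = 1 - 7 * fps_X ^ 1 + 21 * fps_X ^ 2 - 35 * fps_X ^ 3 + 35 * fps_X ^ 4
      - 21 * fps_X ^ 5 + 7 * fps_X ^ 6 - fps_X ^ 7"
    by algebra
  have "(1 - fps_X) ^ 7 * ?H = ?N"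
  proof (rule fps_ext)
    fix n
    have l: "fps_nth ((1 - fps_X) ^ 7 * ?H) n = h n - 7 * (if n < 1 then 0 else h (n - 1)) + 21 * (if n < 2 then 0 else h (n - 2))
       - 35 * (if n < 3 then 0 else h (n - 3)) + 35 * (if n < 4 then 0 else h (n - 4))
       - 21 * (if n < 5 then 0 else h (n - 5)) + 7 * (if n < 6 then 0 else h (n - 6)) - (if n < 7 then 0 else h (n - 7))"
      unfolding e
      by (simp only: ring_distribs mult_1_left mult.assoc fps_add_nth fps_sub_nth numeral_fps_const
           fps_mult_left_const_nth fps_X_power_mult_nth fps_nth_Abs_fps)
    have r: "fps_nth ?N n = (if n = 0 then 1 else 0) + 9 * (if n = 1 then 1 else 0) + 27 * (if n = 2 then 1 else 0)
       + 19 * (if n = 3 then 1 else 0) - 30 * (if n = 4 then 1 else 0) + 34 * (if n = 5 then 1 else 0)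
       - 35 * (if n = 6 then 1 else 0) + 21 * (if n = 7 then 1 else 0) - 7 * (if n = 8 then 1 else 0) + (if n = 9 then 1 else 0)"
      by (simp only: fps_add_nth fps_sub_nth numeral_fps_const fps_mult_left_const_nth fps_X_power_nth fps_X_nth fps_one_nth)
    show "fps_nth ((1 - fps_X) ^ 7 * ?H) n = fps_nth ?N n"
    \<comment> \<open>The exceptional value at 2 affects coefficients up to 2 + 7 = 9, which is also
      the degree of the numerator. From 10 on all shifted arguments are at least 3, and only the
      polynomial is involved.\<close>
    proof (cases "n < 10")
      case True
      hence "n \<in> {0,1,2,3,4,5,6,7,8,9}" by auto
      thus ?thesis unfolding l r by (elim insertE emptyE) (simp_all add: h)
    next
      case False
      then obtain m where m: "n = m + 10" by (metis add.commute le_Suc_ex not_less)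
      show ?thesis unfolding l r
        by (simp add: m h) (simp add: field_simps power_numeral_reduce)
    qed
  qed
  moreover have "(1 - fps_X :: real fps) ^ 7 \<noteq> 0"
  proof -
    have "fps_nth (1 - fps_X :: real fps) 0 \<noteq> fps_nth 0 0" by simp
    hence "(1 - fps_X :: real fps) \<noteq> 0" by metis
    thus ?thesis by simp
  qed
  ultimately show ?thesis by (metis nonzero_mult_div_cancel_left)
qed

theorem theorem3p5:
  shows "hilbert_series cone_O4 =
           (1 + 9 * fps_X + 27 * fps_X^2 + 19 * fps_X^3 - 30 * fps_X^4 + 34 * fps_X^5
              - 35 * fps_X^6 + 21 * fps_X^7 - 7 * fps_X^8 + fps_X^9) / (1 - fps_X) ^ 7
         \<and> (\<forall>d::nat. real (hilb_coeff cone_O4 d) =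
              (if d = 2 then 118
               else 1/18 * real d^6 + 2/3 * real d^5 + 20/9 * real d^4 + 4 * real d^3
                    + 85/18 * real d^2 + 10/3 * real d + 1))"
  unfolding hilbert_series_def using hilbert_series_eq[OF hilb_coeff_cone] hilb_coeff_cone by blast

end
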